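(* For every integer $d \geq 1$ there exists a finitely presented group $G$ whose conjugator length function satisfies $\mathrm{CL}(n) \simeq n^d$.
   Context: Let $G$ be a group with a fixed finite generating set $S$. Words are finite words in the letters $S^{\pm 1}$, and $|w|$ denotes the length of a word $w$. Write $u \sim v$ if the words $u$ and $v$ represent conjugate elements of $G$. For words $u \sim v$, let $\mathrm{CL}(u,v)$ be the length of a shortest word $w$ such that $uw = wv$ in $G$. The conjugator length function $\mathrm{CL} : \mathbb{N} \to \mathbb{N}$ of $G$ is $$\mathrm{CL}(n) = \max\{\mathrm{CL}(u,v) \mid \text{words } u, v \text{ with } u \sim v \text{ in } G \text{ and } |u|+|v| \leq n\}.$$ For functions $f,g : \mathbb{N} \to \mathbb{N}$, write $f \preceq g$ if there exists a constant $C>0$ (which may be taken to be an integer) such that $f(n) \leq C g(Cn+C) + C$ for all $n \in \mathbb{N}$; write $f \simeq g$ if $f \preceq g$ and $g \preceq f$. The $\simeq$-class of $\mathrm{CL}$ does not depend on the choice of finite generating set. *)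

theory Defs
  imports "HOL-Algebra.Generated_Groups"
begin

text \<open>The letter \<open>(x, True)\<close> stands for \<open>x\<close> and \<open>(x, False)\<close> for the formal inverse of \<open>x\<close>;
  words need not be reduced.\<close>

type_synonym 'a gword = "('a \<times> bool) list"

definition gwords :: "'a set \<Rightarrow> 'a gword set" where
  "gwords X = lists (X \<times> UNIV)"

text \<open>\<open>pres_eq X R u v\<close>: the words \<open>u\<close> and \<open>v\<close> over \<open>X\<close> represent the same element of the group
  \<open>\<langle>X | R\<rangle>\<close>.\<close>

inductive pres_eq :: "'x set \<Rightarrow> 'x gword set \<Rightarrow> 'x gword \<Rightarrow> 'x gword \<Rightarrow> bool"
  for X R where
  pres_refl: "w \<in> gwords X \<Longrightarrow> pres_eq X R w w"
| pres_sym: "pres_eq X R u v \<Longrightarrow> pres_eq X R v u"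
| pres_trans: "pres_eq X R u v \<Longrightarrow> pres_eq X R v w \<Longrightarrow> pres_eq X R u w"
| pres_cancel: "u \<in> gwords X \<Longrightarrow> v \<in> gwords X \<Longrightarrow> x \<in> X \<Longrightarrow>
    pres_eq X R (u @ [(x, b), (x, \<not> b)] @ v) (u @ v)"
| pres_rel: "u \<in> gwords X \<Longrightarrow> v \<in> gwords X \<Longrightarrow> r \<in> R \<Longrightarrow>
    pres_eq X R (u @ r @ v) (u @ v)"

definition pres_class :: "'x set \<Rightarrow> 'x gword set \<Rightarrow> 'x gword \<Rightarrow> 'x gword set" where
  "pres_class X R u = {v. pres_eq X R u v}"

definition presented_group :: "'x set \<Rightarrow> 'x gword set \<Rightarrow> 'x gword set monoid" where
  "presented_group X R =
    \<lparr>carrier = pres_class X R ` gwords X,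
     mult = (\<lambda>A B. \<Union>u\<in>A. \<Union>v\<in>B. pres_class X R (u @ v)),
     one = pres_class X R []\<rparr>"

text \<open>Since the alphabet is finite, it may be taken to consist of natural numbers.\<close>

definition finitely_presented :: "('a, 'm) monoid_scheme \<Rightarrow> bool" where
  "finitely_presented G \<longleftrightarrow>
    (\<exists>(X :: nat set) R. finite X \<and> finite R \<and> R \<subseteq> gwords X \<and> G \<cong> presented_group X R)"

lemma gwords_Nil [simp]: "[] \<in> gwords X"
  by (simp add: gwords_def)

lemma gwords_append [simp]: "u @ v \<in> gwords X \<longleftrightarrow> u \<in> gwords X \<and> v \<in> gwords X"
  by (auto simp: gwords_def)

lemma gwords_Cons [simp]: "(x, b) # w \<in> gwords X \<longleftrightarrow> x \<in> X \<and> w \<in> gwords X"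
  by (auto simp: gwords_def)

lemma pres_eq_gwords:
  assumes "R \<subseteq> gwords X" "pres_eq X R u v"
  shows "u \<in> gwords X \<and> v \<in> gwords X"
  using assms(2,1) by (induction) auto

lemma pres_eq_context:
  assumes "pres_eq X R u v" "a \<in> gwords X" "b \<in> gwords X"
  shows "pres_eq X R (a @ u @ b) (a @ v @ b)"
  using assms
proof (induction)
  case (pres_refl w)
  then show ?case by (simp add: pres_eq.pres_refl)
next
  case (pres_sym u v)
  then show ?case by (simp add: pres_eq.pres_sym)
next
  case (pres_trans u v w)
  then show ?case by (meson pres_eq.pres_trans)
next
  case (pres_cancel u v x c)
  then show ?case
    using pres_eq.pres_cancel[of "a @ u" X "v @ b" x R c] by simp
next
  case (pres_rel u v r)
  then show ?case
    using pres_eq.pres_rel[of "a @ u" X "v @ b" r R] by simp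
qed

lemma pres_eq_append:
  assumes "R \<subseteq> gwords X" "pres_eq X R u u'" "pres_eq X R v v'"
  shows "pres_eq X R (u @ v) (u' @ v')"
proof -
  have "pres_eq X R (u @ v) (u' @ v)"
    using pres_eq_context[OF assms(2), of "[]" v] pres_eq_gwords[OF assms(1,3)] by simp
  moreover have "pres_eq X R (u' @ v) (u' @ v')"
    using pres_eq_context[OF assms(3), of u' "[]"] pres_eq_gwords[OF assms(1,2)] by simp
  ultimately show ?thesis by (rule pres_eq.pres_trans)
qed

lemma pres_class_eq_iff:
  assumes "u \<in> gwords X"
  shows "pres_class X R u = pres_class X R v \<longleftrightarrow> pres_eq X R u v"
proof
  assume "pres_class X R u = pres_class X R v"
  moreover have "u \<in> pres_class X R u"
    using assms by (simp add: pres_class_def pres_eq.pres_refl)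
  ultimately show "pres_eq X R u v"
    by (simp add: pres_class_def pres_eq.pres_sym)
next
  assume "pres_eq X R u v"
  then show "pres_class X R u = pres_class X R v"
    unfolding pres_class_def
    by (intro Collect_cong iffI) (blast intro: pres_eq.pres_trans pres_eq.pres_sym)+
qed

lemma presented_group_mult:
  assumes "R \<subseteq> gwords X" "u \<in> gwords X" "v \<in> gwords X"
  shows "pres_class X R u \<otimes>\<^bsub>presented_group X R\<^esub> pres_class X R v = pres_class X R (u @ v)"
proof -
  let ?A = "pres_class X R u" and ?B = "pres_class X R v"
  have eq: "pres_class X R (u' @ v') = pres_class X R (u @ v)" if "u' \<in> ?A" "v' \<in> ?B" for u' v'
  proof -
    have "pres_eq X R (u @ v) (u' @ v')"
      using that by (intro pres_eq_append[OF assms(1)]) (simp_all add: pres_class_def)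
    then show ?thesis
      using assms pres_class_eq_iff[of "u @ v" X R "u' @ v'"] by simp
  qed
  have mem: "u \<in> ?A" "v \<in> ?B"
    using assms by (simp_all add: pres_class_def pres_eq.pres_refl)
  have "(\<Union>u'\<in>?A. \<Union>v'\<in>?B. pres_class X R (u' @ v')) = pres_class X R (u @ v)"
  proof (intro equalityI subsetI)
    fix w assume "w \<in> (\<Union>u'\<in>?A. \<Union>v'\<in>?B. pres_class X R (u' @ v'))"
    then obtain u' v' where uv: "u' \<in> ?A" "v' \<in> ?B" "w \<in> pres_class X R (u' @ v')"
      by (elim UN_E)
    then show "w \<in> pres_class X R (u @ v)"
      using eq[OF uv(1,2)] by (simp only:)
  next
    fix w assume "w \<in> pres_class X R (u @ v)"
    then show "w \<in> (\<Union>u'\<in>?A. \<Union>v'\<in>?B. pres_class X R (u' @ v'))"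
      by (intro UN_I[OF mem(1)] UN_I[OF mem(2)])
  qed
  then show ?thesis
    by (simp only: presented_group_def monoid.simps)
qed

lemma pres_left_inverse:
  assumes "w \<in> gwords X"
  shows "\<exists>w'\<in>gwords X. pres_eq X R (w' @ w) []"
  using assms
proof (induction w)
  case Nil
  then show ?case by (intro bexI[of _ "[]"]) (simp_all add: pres_eq.pres_refl)
next
  case (Cons a w)
  obtain x b where a: "a = (x, b)" by (cases a)
  with Cons obtain w' where w': "w' \<in> gwords X" "pres_eq X R (w' @ w) []"
    by auto
  have "pres_eq X R (w' @ [(x, \<not> b), (x, \<not> \<not> b)] @ w) (w' @ w)"
    using Cons.prems w' a by (intro pres_eq.pres_cancel) auto
  then have "pres_eq X R ((w' @ [(x, \<not> b)]) @ a # w) []"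
    using pres_eq.pres_trans[OF _ w'(2)] a by simp
  then show ?case
    using w' Cons.prems a by (intro bexI[of _ "w' @ [(x, \<not> b)]"]) auto
qed

lemma group_presented_group:
  assumes "R \<subseteq> gwords X"
  shows "group (presented_group X R)"
proof -
  note m = presented_group_mult[OF assms]
  have c: "carrier (presented_group X R) = pres_class X R ` gwords X"
    and o: "\<one>\<^bsub>presented_group X R\<^esub> = pres_class X R []"
    by (simp_all add: presented_group_def)
  show ?thesis
  proof (rule groupI)
    fix A assume "A \<in> carrier (presented_group X R)"
    then obtain w where w: "w \<in> gwords X" "A = pres_class X R w" using c by auto
    obtain w' where w': "w' \<in> gwords X" "pres_eq X R (w' @ w) []"
      using pres_left_inverse[OF w(1)] by blast
    show "\<exists>B\<in>carrier (presented_group X R). B \<otimes>\<^bsub>presented_group X R\<^esub> A = \<one>\<^bsub>presented_group X R\<^esub>"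
    proof (rule bexI)
      have "pres_class X R (w' @ w) = pres_class X R []"
        using w w' pres_class_eq_iff[of "w' @ w" X R "[]"] by simp
      then show "pres_class X R w' \<otimes>\<^bsub>presented_group X R\<^esub> A = \<one>\<^bsub>presented_group X R\<^esub>"
        using m[OF w'(1) w(1)] w(2) o by simp
      show "pres_class X R w' \<in> carrier (presented_group X R)"
        using w' c by simp
    qed
  qed (auto simp: c o m)
qed

definition word_val :: "('a, 'm) monoid_scheme \<Rightarrow> 'a gword \<Rightarrow> 'a" where
  "word_val G w =
    foldr (\<lambda>(s, b) g. (if b then s else inv\<^bsub>G\<^esub> s) \<otimes>\<^bsub>G\<^esub> g) w \<one>\<^bsub>G\<^esub>"

definition conj_words :: "('a, 'm) monoid_scheme \<Rightarrow> 'a gword \<Rightarrow> 'a gword \<Rightarrow> bool" where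
  "conj_words G u v \<longleftrightarrow>
    (\<exists>g\<in>carrier G. word_val G v = inv\<^bsub>G\<^esub> g \<otimes>\<^bsub>G\<^esub> word_val G u \<otimes>\<^bsub>G\<^esub> g)"

text \<open>Meaningful only for \<open>u\<close>, \<open>v\<close> with \<open>conj_words G u v\<close>, and for \<open>S\<close> generating \<open>G\<close>.\<close>

definition CL_words :: "('a, 'm) monoid_scheme \<Rightarrow> 'a set \<Rightarrow> 'a gword \<Rightarrow> 'a gword \<Rightarrow> nat" where
  "CL_words G S u v = (LEAST k. \<exists>w\<in>gwords S. length w = k \<and>
    word_val G u \<otimes>\<^bsub>G\<^esub> word_val G w = word_val G w \<otimes>\<^bsub>G\<^esub> word_val G v)"

definition CL :: "('a, 'm) monoid_scheme \<Rightarrow> 'a set \<Rightarrow> nat \<Rightarrow> nat" where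
  "CL G S n = Max {CL_words G S u v | u v.
    u \<in> gwords S \<and> v \<in> gwords S \<and> conj_words G u v \<and> length u + length v \<le> n}"

text \<open>For finite \<open>S\<close> the maximum is taken over a finite nonempty set.\<close>

lemma CL_set_finite_nonempty:
  assumes "group G" "finite S"
  shows "finite {CL_words G S u v | u v.
      u \<in> gwords S \<and> v \<in> gwords S \<and> conj_words G u v \<and> length u + length v \<le> n}" (is "finite ?A")
    and "{CL_words G S u v | u v.
      u \<in> gwords S \<and> v \<in> gwords S \<and> conj_words G u v \<and> length u + length v \<le> n} \<noteq> {}"
proof -
  let ?W = "{w. set w \<subseteq> S \<times> (UNIV :: bool set) \<and> length w \<le> n}"
  have "finite ?W" using assms(2) by (intro finite_lists_length_le) simp
  moreover have "?A \<subseteq> (\<lambda>(u, v). CL_words G S u v) ` (?W \<times> ?W)"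
  proof
    fix k assume "k \<in> ?A"
    then obtain u v where "k = CL_words G S u v" "u \<in> ?W" "v \<in> ?W"
      unfolding gwords_def lists_eq_set by fastforce
    then show "k \<in> (\<lambda>(u, v). CL_words G S u v) ` (?W \<times> ?W)"
      by (intro image_eqI[of _ _ "(u, v)"]) auto
  qed
  ultimately show "finite ?A" by (meson finite_SigmaI finite_imageI finite_subset)
  interpret group G by fact
  have "conj_words G [] []"
    unfolding conj_words_def word_val_def by (rule bexI[of _ "\<one>\<^bsub>G\<^esub>"]) simp_all
  then have "CL_words G S [] [] \<in> ?A"
    by (intro CollectI exI[of _ "[]"] conjI) simp_all
  then show "?A \<noteq> {}"
    by blast
qed

definition growth_le :: "(nat \<Rightarrow> nat) \<Rightarrow> (nat \<Rightarrow> nat) \<Rightarrow> bool" (infix \<open>\<preceq>\<close> 50) where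
  "f \<preceq> g \<longleftrightarrow> (\<exists>C>0. \<forall>n. f n \<le> C * g (C * n + C) + C)"

definition growth_equiv :: "(nat \<Rightarrow> nat) \<Rightarrow> (nat \<Rightarrow> nat) \<Rightarrow> bool" (infix \<open>\<simeq>\<close> 50) where
  "f \<simeq> g \<longleftrightarrow> f \<preceq> g \<and> g \<preceq> f"

end

(* For d >= 2 take the model filiform group Z[X]/(X^d) x| Z, where the generator t of Z acts as
   multiplication by 1 + X; for d = 1 the group of the Klein bottle, Z x| Z with t acting as -1.

   Lower bound, d >= 2: the iterated commutators of X^0 with t^N show that N^d X^(d-1) has word length
   O(N), while every conjugator from X^(d-2) to X^(d-2) + N^d X^(d-1) has t-exponent -N^d.
   For d = 1, every conjugator from t to (2N) t has module coordinate of absolute value N.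

   Upper bound: in a word of length n the coefficient of X^i is O(n^(i+1)). If (a, t^k) and (b, t^k)
   are conjugate with k = 0, then a = t^m b and comparing the coefficient after the lowest one of b
   gives m = O(n^d), or m may be taken to be 0. If k is nonzero, multiplying the conjugator by powers
   of (a, t^k) reduces its exponent m modulo k; its module coordinate c then solves
   (1 - t^k) c = a - t^m b, for d >= 2 a triangular system with diagonal entries -k. Its solution has
   coefficients O(n^d), and the word length of c is at most linear in the sum of its coefficients. *)
theory Submission
  imports Defs "HOL-Computational_Algebra.Formal_Power_Series"
begin

text \<open>Coefficients of high powers of X are distorted, so measuring a module element by the sum
  of its coefficients is crude. The two bounds still meet: the crude measure is applied only to
  coefficients that are O(n^d), while the lower bound reads off a quantity that is at most linear in
  word length, the t-exponent for d >= 2 and the module coordinate for d = 1. With 1 + X as the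
  action, d = 1 would give the abelian group Z^2, whose conjugator length is 0; hence the separate
  action by -1. The delicate point is back substitution in the triangular system: estimating the
  entries by powers of n alone loses an extra power at every step. The bounds on the off-diagonal
  entries must keep a factor |k|, which cancels against the division by the diagonal entry. The
  claim concerns every finite generating set, so lengths are compared in both directions: the
  finitely many letters have bounded coefficients, and the standard generators lie in some
  ball.\<close>

unbundle fps_syntax

section \<open>Words, balls and conjugators\<close>

lemma (in group) word_val_closed:
  assumes "S \<subseteq> carrier G" "w \<in> gwords S"
  shows "word_val G w \<in> carrier G"
  using assms(2) by (induction w) (use assms(1) in \<open>auto simp: word_val_def\<close>)

lemma word_val_Nil [simp]: "word_val G [] = \<one>\<^bsub>G\<^esub>"
  by (simp add: word_val_def)

lemma word_val_Cons [simp]: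
  "word_val G ((x, b) # w) = (if b then x else inv\<^bsub>G\<^esub> x) \<otimes>\<^bsub>G\<^esub> word_val G w"
  by (simp add: word_val_def)

lemma (in group) word_val_append:
  assumes "S \<subseteq> carrier G" "u \<in> gwords S" "v \<in> gwords S"
  shows "word_val G (u @ v) = word_val G u \<otimes> word_val G v"
  using assms(2)
proof (induction u)
  case Nil
  then show ?case using word_val_closed[OF assms(1,3)] by simp
next
  case (Cons a u)
  then show ?case
    using word_val_closed[OF assms(1,3)] word_val_closed[OF assms(1), of u] assms(1)
    by (cases a) (auto simp: m_assoc subset_iff)
qed

text \<open>Balls stand in for a word length function: an element outside the subgroup generated by
  \<open>S\<close> lies in no ball, and no length has to be assigned to it.\<close>

definition word_ball :: "('a, 'm) monoid_scheme \<Rightarrow> 'a set \<Rightarrow> nat \<Rightarrow> 'a set" where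
  "word_ball G S n = word_val G ` {w \<in> gwords S. length w \<le> n}"

lemma word_ballI: "w \<in> gwords S \<Longrightarrow> length w \<le> n \<Longrightarrow> word_val G w \<in> word_ball G S n"
  by (auto simp: word_ball_def)

lemma word_ballE:
  assumes "x \<in> word_ball G S n"
  obtains w where "w \<in> gwords S" "length w \<le> n" "x = word_val G w"
  using assms by (auto simp: word_ball_def)

lemma word_ball_mono: "x \<in> word_ball G S m \<Longrightarrow> m \<le> n \<Longrightarrow> x \<in> word_ball G S n"
  by (auto simp: word_ball_def)

locale group_subset = group G for G (structure) +
  fixes S
  assumes S_carrier: "S \<subseteq> carrier G"
begin

lemma ball_closed: "x \<in> word_ball G S n \<Longrightarrow> x \<in> carrier G"
  using word_val_closed[OF S_carrier] by (auto simp: word_ball_def)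

lemma ball_one: "\<one> \<in> word_ball G S n"
  using word_ballI[of "[]" S n G] by simp

lemma ball_mult:
  assumes "x \<in> word_ball G S m" "y \<in> word_ball G S n"
  shows "x \<otimes> y \<in> word_ball G S (m + n)"
proof -
  obtain u v where u: "u \<in> gwords S" "length u \<le> m" "x = word_val G u"
    and v: "v \<in> gwords S" "length v \<le> n" "y = word_val G v"
    using assms by (elim word_ballE)
  then have "word_val G (u @ v) \<in> word_ball G S (m + n)"
    by (intro word_ballI) auto
  then show ?thesis using u v word_val_append[OF S_carrier] by simp
qed

lemma ball_letter: "x \<in> S \<Longrightarrow> x \<in> word_ball G S 1" "x \<in> S \<Longrightarrow> inv x \<in> word_ball G S 1"
  using word_ballI[of "[(x, True)]" S 1 G] word_ballI[of "[(x, False)]" S 1 G] S_carrier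
  by auto

lemma ball_inv:
  assumes "x \<in> word_ball G S n"
  shows "inv x \<in> word_ball G S n"
proof -
  have "inv (word_val G w) \<in> word_ball G S (length w)" if "w \<in> gwords S" for w
    using that
  proof (induction w)
    case Nil
    then show ?case using ball_one by simp
  next
    case (Cons a w)
    obtain x b where a: "a = (x, b)" by (cases a)
    let ?y = "if b then x else inv x"
    have x: "x \<in> S" and w: "w \<in> gwords S" using Cons.prems a by auto
    have "inv ?y \<in> word_ball G S 1"
      using ball_letter[OF x] S_carrier x by auto
    then have "inv (word_val G w) \<otimes> inv ?y \<in> word_ball G S (length w + 1)"
      using Cons.IH w by (intro ball_mult) auto
    moreover have "inv (?y \<otimes> word_val G w) = inv (word_val G w) \<otimes> inv ?y"
      using x S_carrier word_val_closed[OF S_carrier w] by (intro inv_mult_group) auto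
    ultimately show ?case by (simp add: a)
  qed
  then show ?thesis
    using assms by (auto elim!: word_ballE intro: word_ball_mono)
qed

lemma ball_pow:
  assumes "x \<in> word_ball G S n"
  shows "x [^] (k :: int) \<in> word_ball G S (n * nat \<bar>k\<bar>)"
proof -
  have *: "x [^] (j :: nat) \<in> word_ball G S (n * j)" for j
  proof (induction j)
    case 0
    then show ?case using ball_one by simp
  next
    case (Suc j)
    from ball_mult[OF this assms] show ?case by (simp add: add.commute)
  qed
  show ?thesis
  proof (cases "k \<ge> 0")
    case True
    then show ?thesis using *[of "nat k"] unfolding int_pow_def2 by simp
  next
    case False
    then show ?thesis using ball_inv[OF *[of "nat (- k)"]] unfolding int_pow_def2 by simp
  qed
qed

lemma generate_ball: "x \<in> generate G S \<Longrightarrow> \<exists>n. x \<in> word_ball G S n"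
proof (induction rule: generate.induct)
  case one
  then show ?case using ball_one by blast
next
  case (incl h)
  then show ?case using ball_letter by blast
next
  case (inv h)
  then show ?case using ball_letter by blast
next
  case (eng h1 h2)
  then show ?case using ball_mult by blast
qed

lemma finite_generate_ball:
  assumes "finite A" "A \<subseteq> generate G S"
  shows "\<exists>n. A \<subseteq> word_ball G S n"
  using assms
proof (induction A)
  case empty
  then show ?case by simp
next
  case (insert x A)
  then obtain n where "A \<subseteq> word_ball G S n" by auto
  moreover obtain m where "x \<in> word_ball G S m"
    using insert.prems generate_ball by auto
  ultimately have "insert x A \<subseteq> word_ball G S (max m n)"
    by (auto intro: word_ball_mono)
  then show ?case by blast
qed

lemma conj_words_iff:
  assumes "u \<in> gwords S" "v \<in> gwords S"
  shows "conj_words G u v \<longleftrightarrow>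
    (\<exists>g\<in>carrier G. word_val G u \<otimes> g = g \<otimes> word_val G v)"
  unfolding conj_words_def
proof (intro bex_cong refl)
  fix g assume g: "g \<in> carrier G"
  have "word_val G u \<in> carrier G" "word_val G v \<in> carrier G"
    using word_val_closed[OF S_carrier] assms by auto
  with g show "word_val G v = inv g \<otimes> word_val G u \<otimes> g \<longleftrightarrow>
      word_val G u \<otimes> g = g \<otimes> word_val G v"
    using inv_solve_left[of "word_val G v" g "word_val G u \<otimes> g"] by (simp add: m_assoc)
qed

text \<open>If |u| + |v| <= n, the values of both words lie in the ball of radius n, and any word
  for a conjugating \<open>h\<close> bounds the \<open>LEAST\<close> in \<open>CL_words\<close>.
  Testing this larger set of pairs is harmless, since constant factors in n do not matter.\<close>

lemma CL_le:
  assumes "finite S"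
    and "\<And>x y g. x \<in> word_ball G S n \<Longrightarrow> y \<in> word_ball G S n \<Longrightarrow> g \<in> carrier G \<Longrightarrow>
      x \<otimes> g = g \<otimes> y \<Longrightarrow> \<exists>h\<in>word_ball G S k. x \<otimes> h = h \<otimes> y"
  shows "CL G S n \<le> k"
  unfolding CL_def
proof (subst Max_le_iff[OF CL_set_finite_nonempty[OF is_group assms(1)]], safe)
  fix u v
  assume uv: "u \<in> gwords S" "v \<in> gwords S" "conj_words G u v" "length u + length v \<le> n"
  then obtain g where "g \<in> carrier G" "word_val G u \<otimes> g = g \<otimes> word_val G v"
    using conj_words_iff by blast
  then obtain h where "h \<in> word_ball G S k" "word_val G u \<otimes> h = h \<otimes> word_val G v"
    using assms(2)[of "word_val G u" "word_val G v" g] uv word_ballI[of u S n G]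
      word_ballI[of v S n G] by auto
  then obtain w where w: "w \<in> gwords S" "length w \<le> k"
    "word_val G u \<otimes> word_val G w = word_val G w \<otimes> word_val G v"
    by (auto elim: word_ballE)
  then have "CL_words G S u v \<le> length w"
    unfolding CL_words_def by (intro Least_le) auto
  with w(2) show "CL_words G S u v \<le> k" by simp
qed

text \<open>Generation by \<open>S\<close> provides a word for \<open>g\<close>, so the predicate
  under \<open>LEAST\<close> in \<open>CL_words\<close> is satisfiable and the least length is
  attained. Lower bounds on \<open>CL\<close> are obtained by testing the resulting
  \<open>h\<close>.\<close>

lemma CL_conjugator:
  assumes "finite S" "generate G S = carrier G"
    and "x \<in> word_ball G S m" "y \<in> word_ball G S n"
    and "g \<in> carrier G" "x \<otimes> g = g \<otimes> y"
  shows "\<exists>h\<in>word_ball G S (CL G S (m + n)). x \<otimes> h = h \<otimes> y"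
proof -
  obtain u v where u: "u \<in> gwords S" "length u \<le> m" "x = word_val G u"
    and v: "v \<in> gwords S" "length v \<le> n" "y = word_val G v"
    using assms(3,4) by (elim word_ballE)
  obtain w where w: "w \<in> gwords S" "g = word_val G w"
    using generate_ball[of g] assms(2,5) by (auto elim!: word_ballE)
  let ?P = "\<lambda>k. \<exists>w\<in>gwords S. length w = k \<and>
    word_val G u \<otimes> word_val G w = word_val G w \<otimes> word_val G v"
  have "?P (length w)" using w u v assms(6) by auto
  then have "?P (CL_words G S u v)"
    unfolding CL_words_def by (rule LeastI)
  moreover have "CL_words G S u v \<le> CL G S (m + n)"
    unfolding CL_def
  proof (rule Max_ge[OF CL_set_finite_nonempty(1)[OF is_group assms(1)]])
    have "conj_words G u v"
      using conj_words_iff u v assms(5,6) by blast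
    then show "CL_words G S u v \<in> {CL_words G S u v | u v. u \<in> gwords S \<and> v \<in> gwords S \<and>
        conj_words G u v \<and> length u + length v \<le> m + n}"
      using u v by (intro CollectI exI[of _ u] exI[of _ v]) auto
  qed
  ultimately show ?thesis
    using u v by (metis word_ballI)
qed

end

section \<open>Invariance of conjugator length under isomorphism\<close>

lemma gwords_image: "gwords (h ` S) = map (apfst h) ` gwords S"
proof -
  have "h ` S \<times> UNIV = apfst h ` (S \<times> (UNIV :: bool set))" by force
  then show ?thesis by (simp add: gwords_def lists_image)
qed

lemma word_val_hom:
  assumes "group G" "group H" "h \<in> hom G H" "S \<subseteq> carrier G" "w \<in> gwords S"
  shows "word_val H (map (apfst h) w) = h (word_val G w)"
proof -
  interpret group_hom G H h using assms by (simp add: group_hom_def group_hom_axioms_def)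
  show ?thesis
    using assms(5)
  proof (induction w)
    case (Cons a w)
    obtain x b where a: "a = (x, b)" by (cases a)
    then show ?case
      using Cons assms(4) G.word_val_closed[OF assms(4), of w] by (auto simp: subset_iff)
  qed simp
qed

text \<open>Relabelling letters by \<open>h\<close> preserves lengths and, by injectivity on the
  carrier, every conjugation equation; so the sets under \<open>LEAST\<close> and \<open>Max\<close>
  agree.\<close>

lemma CL_iso:
  assumes "group G" "group H" "h \<in> iso G H" "S \<subseteq> carrier G"
  shows "CL H (h ` S) n = CL G S n"
proof -
  have hom: "h \<in> hom G H" and bij: "bij_betw h (carrier G) (carrier H)"
    using assms(3) by (auto simp: iso_def)
  interpret group_hom G H h using assms hom by (simp add: group_hom_def group_hom_axioms_def)
  interpret GS: group_subset G S using assms(1,4) by (simp add: group_subset_def group_subset_axioms_def)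
  interpret HS: group_subset H "h ` S"
    using assms by (auto simp: group_subset_def group_subset_axioms_def)
  let ?m = "map (apfst h)"
  note wv = word_val_hom[OF assms(1,2) hom assms(4)]
  note cl = G.word_val_closed[OF assms(4)]
  have inj: "inj_on h (carrier G)" using bij by (simp add: bij_betw_def)
  have eq: "word_val H (?m u) \<otimes>\<^bsub>H\<^esub> h g = h g \<otimes>\<^bsub>H\<^esub> word_val H (?m v) \<longleftrightarrow>
      word_val G u \<otimes>\<^bsub>G\<^esub> g = g \<otimes>\<^bsub>G\<^esub> word_val G v"
    if "u \<in> gwords S" "v \<in> gwords S" "g \<in> carrier G" for u v g
    using that cl wv inj_on_eq_iff[OF inj, of "word_val G u \<otimes>\<^bsub>G\<^esub> g" "g \<otimes>\<^bsub>G\<^esub> word_val G v"]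
    by simp
  have CLw: "CL_words H (h ` S) (?m u) (?m v) = CL_words G S u v"
    if uv: "u \<in> gwords S" "v \<in> gwords S" for u v
  proof -
    have "word_val H (?m u) \<otimes>\<^bsub>H\<^esub> word_val H (?m w) = word_val H (?m w) \<otimes>\<^bsub>H\<^esub> word_val H (?m v) \<longleftrightarrow>
        word_val G u \<otimes>\<^bsub>G\<^esub> word_val G w = word_val G w \<otimes>\<^bsub>G\<^esub> word_val G v"
      if "w \<in> gwords S" for w
      using eq[OF uv cl[OF that]] by (simp only: wv[OF that])
    then show ?thesis
      unfolding CL_words_def gwords_image bex_simps(7) length_map
      by (intro arg_cong[where f = Least] ext bex_cong refl) simp
  qed
  have cw: "conj_words H (?m u) (?m v) \<longleftrightarrow> conj_words G u v"
    if "u \<in> gwords S" "v \<in> gwords S" for u v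
  proof -
    have "conj_words H (?m u) (?m v) \<longleftrightarrow>
        (\<exists>g\<in>carrier H. word_val H (?m u) \<otimes>\<^bsub>H\<^esub> g = g \<otimes>\<^bsub>H\<^esub> word_val H (?m v))"
      using that by (intro HS.conj_words_iff) (auto simp: gwords_image)
    also have "carrier H = h ` carrier G" using bij by (simp add: bij_betw_def)
    finally show ?thesis using eq[OF that] GS.conj_words_iff[OF that] by auto
  qed
  have "{CL_words H (h ` S) u v | u v. u \<in> gwords (h ` S) \<and> v \<in> gwords (h ` S) \<and>
      conj_words H u v \<and> length u + length v \<le> n} =
    {CL_words G S u v | u v. u \<in> gwords S \<and> v \<in> gwords S \<and>
      conj_words G u v \<and> length u + length v \<le> n}" (is "?A = ?B")
  proof (intro equalityI subsetI)
    fix k assume "k \<in> ?A"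
    then obtain u v where "k = CL_words H (h ` S) (?m u) (?m v)" "u \<in> gwords S" "v \<in> gwords S"
      "conj_words H (?m u) (?m v)" "length (?m u) + length (?m v) \<le> n"
      unfolding gwords_image by blast
    then show "k \<in> ?B"
      using CLw cw by (intro CollectI exI[of _ u] exI[of _ v]) simp
  next
    fix k assume "k \<in> ?B"
    then obtain u v where "k = CL_words G S u v" "u \<in> gwords S" "v \<in> gwords S"
      "conj_words G u v" "length u + length v \<le> n" by blast
    then show "k \<in> ?A"
      unfolding gwords_image using CLw cw
      by (intro CollectI exI[of _ "?m u"] exI[of _ "?m v"]) simp
  qed
  then show ?thesis by (simp add: CL_def)
qed

section \<open>Semidirect products of truncated power series with the integers\<close>

text \<open>Image of a truncated power series under X^i \<mapsto> \<open>\<alpha> i\<close>. The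
  factors come in a fixed order, because the target group is not commutative.\<close>

primrec coeff_prod :: "('a, 'm) monoid_scheme \<Rightarrow> (nat \<Rightarrow> 'a) \<Rightarrow> nat \<Rightarrow> int fps \<Rightarrow> 'a" where
  "coeff_prod G \<alpha> 0 f = \<one>\<^bsub>G\<^esub>"
| "coeff_prod G \<alpha> (Suc n) f = coeff_prod G \<alpha> n f \<otimes>\<^bsub>G\<^esub> \<alpha> n [^]\<^bsub>G\<^esub> (f $ n)"

lemma coeff_prod_cong: "(\<And>i. i < n \<Longrightarrow> f $ i = g $ i) \<Longrightarrow> coeff_prod G \<alpha> n f = coeff_prod G \<alpha> n g"
  by (induction n) auto

lemma (in group) conj_hom:
  assumes x: "x \<in> carrier G"
  shows "(\<lambda>y. x \<otimes> y \<otimes> inv x) \<in> hom G G"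
proof -
  have "inv x \<otimes> (x \<otimes> y) = y" if "y \<in> carrier G" for y
    using that x by (simp add: m_assoc[symmetric])
  then show ?thesis using x by (intro homI) (simp_all add: m_assoc)
qed

lemma (in group) commute_int_pow:
  assumes "x \<in> carrier G" "y \<in> carrier G" "x \<otimes> y = y \<otimes> x"
  shows "x \<otimes> y [^] (k :: int) = y [^] k \<otimes> x"
proof -
  have "x \<otimes> y \<otimes> inv x = y"
    using assms by (simp add: m_assoc)
  then have "(x \<otimes> y \<otimes> inv x) [^] k = y [^] k" by simp
  moreover have "x \<otimes> y [^] k \<otimes> inv x = (x \<otimes> y \<otimes> inv x) [^] k"
    using hom_int_pow[OF conj_hom[OF assms(1)], of y k] assms(2) is_group by simp
  ultimately have "x \<otimes> y [^] k \<otimes> inv x = y [^] k" by simp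
  then have "x \<otimes> y [^] k \<otimes> inv x \<otimes> x = y [^] k \<otimes> x" by simp
  then show ?thesis using assms(1,2) by (simp add: m_assoc)
qed

locale commuting_family = group G for G (structure) +
  fixes \<alpha> :: "nat \<Rightarrow> 'a" and D :: nat
  assumes \<alpha>_closed [simp]: "i < D \<Longrightarrow> \<alpha> i \<in> carrier G"
    and \<alpha>_commute: "i < D \<Longrightarrow> j < D \<Longrightarrow> \<alpha> i \<otimes> \<alpha> j = \<alpha> j \<otimes> \<alpha> i"
begin

lemma coeff_prod_closed [simp]: "n \<le> D \<Longrightarrow> coeff_prod G \<alpha> n f \<in> carrier G"
  by (induction n) auto

lemma coeff_prod_commute:
  assumes "n \<le> D" "x \<in> carrier G" "\<And>i. i < n \<Longrightarrow> x \<otimes> \<alpha> i = \<alpha> i \<otimes> x"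
  shows "x \<otimes> coeff_prod G \<alpha> n f = coeff_prod G \<alpha> n f \<otimes> x"
  using assms(1,3)
proof (induction n)
  case 0
  then show ?case using assms(2) by simp
next
  case (Suc n)
  let ?A = "coeff_prod G \<alpha> n f" and ?y = "\<alpha> n [^] (f $ n)"
  have y: "?y \<in> carrier G" "?A \<in> carrier G" using Suc.prems by auto
  have "x \<otimes> (?A \<otimes> ?y) = ?A \<otimes> x \<otimes> ?y"
    using Suc assms(2) y by (simp add: m_assoc[symmetric])
  also have "\<dots> = ?A \<otimes> (?y \<otimes> x)"
    using Suc.prems assms(2) y commute_int_pow[of x "\<alpha> n" "f $ n"] by (simp add: m_assoc)
  finally show ?case using assms(2) y by (simp add: m_assoc)
qed

lemma \<alpha>_pow_coeff_prod_commute: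
  assumes "n \<le> D" "i < D"
  shows "\<alpha> i [^] (k :: int) \<otimes> coeff_prod G \<alpha> n f = coeff_prod G \<alpha> n f \<otimes> \<alpha> i [^] k"
proof -
  have "\<alpha> j \<otimes> \<alpha> i [^] k = \<alpha> i [^] k \<otimes> \<alpha> j" if "j < n" for j
    using that assms \<alpha>_commute[of j i] by (intro commute_int_pow) auto
  then show ?thesis
    using assms by (intro coeff_prod_commute) auto
qed

lemma coeff_prod_add:
  "n \<le> D \<Longrightarrow> coeff_prod G \<alpha> n (f + g) = coeff_prod G \<alpha> n f \<otimes> coeff_prod G \<alpha> n g"
proof (induction n)
  case (Suc n)
  let ?A = "coeff_prod G \<alpha> n f" and ?B = "coeff_prod G \<alpha> n g"
    and ?x = "\<alpha> n [^] (f $ n)" and ?y = "\<alpha> n [^] (g $ n)"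
  have c: "?A \<in> carrier G" "?B \<in> carrier G" "?x \<in> carrier G" "?y \<in> carrier G"
    using Suc.prems by auto
  have "?A \<otimes> ?B \<otimes> (?x \<otimes> ?y) = ?A \<otimes> (?B \<otimes> ?x) \<otimes> ?y"
    using c by (simp add: m_assoc)
  also have "?B \<otimes> ?x = ?x \<otimes> ?B"
    using \<alpha>_pow_coeff_prod_commute[of n n] Suc.prems by simp
  finally show ?case using Suc c by (simp add: int_pow_mult m_assoc)
qed simp

lemma coeff_prod_zero: "n \<le> D \<Longrightarrow> coeff_prod G \<alpha> n 0 = \<one>"
  by (induction n) auto

lemma coeff_prod_uminus:
  assumes "n \<le> D"
  shows "coeff_prod G \<alpha> n (- f) = inv (coeff_prod G \<alpha> n f)"
  using coeff_prod_add[OF assms, of "- f" f] coeff_prod_zero[OF assms] assms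
  by (intro inv_equality[symmetric]) auto

lemma coeff_prod_of_int:
  "n \<le> D \<Longrightarrow> coeff_prod G \<alpha> n (of_int e * f) = coeff_prod G \<alpha> n f [^] e"
proof (induction n)
  case (Suc n)
  have "(coeff_prod G \<alpha> n f \<otimes> \<alpha> n [^] (f $ n)) [^] e =
      coeff_prod G \<alpha> n f [^] e \<otimes> (\<alpha> n [^] (f $ n)) [^] e"
    using Suc.prems \<alpha>_pow_coeff_prod_commute[of n n "f $ n" f]
    by (intro int_pow_mult_distrib) auto
  then show ?case
    using Suc by (simp add: int_pow_pow fps_of_int[symmetric] mult.commute)
qed simp

end

text \<open>\<open>U\<close> is a unit of the full power series ring, so \<open>act\<close> is an
  honest homomorphism from the integers into the units, and truncation enters only in the group law.
  The inverse \<open>V\<close> is a parameter, which makes negative powers explicit.\<close>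

locale unit_action =
  fixes D :: nat and U V :: "int fps"
  assumes UV: "U * V = 1"
begin

definition act :: "int \<Rightarrow> int fps" where
  "act k = (if k \<ge> 0 then U ^ nat k else V ^ nat (- k))"

lemma act_0 [simp]: "act 0 = 1" and act_1 [simp]: "act 1 = U"
  by (simp_all add: act_def)

lemma act_Suc: "act (k + 1) = U * act k"
proof (cases "k \<ge> 0")
  case True
  then show ?thesis by (simp add: act_def nat_add_distrib)
next
  case False
  define j where "j = nat (- 1 - k)"
  have j: "k = - 1 - int j" using False by (simp add: j_def)
  have "nat (- k) = Suc j" "nat (- (k + 1)) = j" using j by auto
  then have "act k = V * V ^ j" "act (k + 1) = V ^ j"
    using j by (auto simp: act_def)
  then show ?thesis using UV by (simp add: mult.assoc[symmetric])
qed

lemma act_pred: "act (k - 1) = V * act k"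
  using act_Suc[of "k - 1"] UV by (simp add: mult.assoc[symmetric] mult.commute[of V])

lemma act_add: "act (j + k) = act j * act k"
proof (induction j rule: int_induct[where k = 0])
  case base
  then show ?case by simp
next
  case (step1 i)
  then show ?case using act_Suc[of i] act_Suc[of "i + k"] by (simp add: algebra_simps)
next
  case (step2 i)
  then show ?case using act_pred[of i] act_pred[of "i + k"] by (simp add: algebra_simps)
qed

text \<open>The truncated power series modulo \<open>fps_X ^ D\<close> are the module on which the stable letter acts
  as multiplication by \<open>U\<close>; the truncation \<open>fps_cutoff D\<close> picks the representative of degree less
  than \<open>D\<close>.\<close>

definition sdp :: "(int fps \<times> int) monoid" where
  "sdp = \<lparr>carrier = {(f, k). fps_cutoff D f = f},
    monoid.mult = (\<lambda>(f, k) (g, l). (fps_cutoff D (f + act k * g), k + l)),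
    one = (0, 0)\<rparr>"

lemma sdp_simps [simp]:
  "(f, k) \<in> carrier sdp \<longleftrightarrow> fps_cutoff D f = f"
  "(f, k) \<otimes>\<^bsub>sdp\<^esub> (g, l) = (fps_cutoff D (f + act k * g), k + l)"
  "\<one>\<^bsub>sdp\<^esub> = (0, 0)"
  by (simp_all add: sdp_def)

lemma cutoff_idem [simp]: "fps_cutoff n (fps_cutoff n f) = fps_cutoff n f"
  by (simp add: fps_eq_iff)

text \<open>Truncation is reduction modulo the ideal generated by X^n; this is behind the
  associativity of the truncated group law.\<close>

lemma cutoff_mult_cutoff [simp]:
  fixes f g :: "int fps"
  shows "fps_cutoff n (f * fps_cutoff n g) = fps_cutoff n (f * g)"
  by (simp add: fps_eq_iff fps_cutoff_right_mult_nth)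

lemma sdp_group: "group sdp"
proof (rule groupI)
  fix p q r assume "p \<in> carrier sdp" "q \<in> carrier sdp" "r \<in> carrier sdp"
  then show "p \<otimes>\<^bsub>sdp\<^esub> q \<otimes>\<^bsub>sdp\<^esub> r = p \<otimes>\<^bsub>sdp\<^esub> (q \<otimes>\<^bsub>sdp\<^esub> r)"
    by (cases p; cases q; cases r)
      (simp add: fps_cutoff_add act_add distrib_left mult.assoc add.assoc)
next
  fix p assume p: "p \<in> carrier sdp"
  obtain f k where "p = (f, k)" by (cases p)
  with p show "\<exists>q\<in>carrier sdp. q \<otimes>\<^bsub>sdp\<^esub> p = \<one>\<^bsub>sdp\<^esub>"
    by (intro bexI[of _ "(fps_cutoff D (- (act (- k) * f)), - k)"])
      (simp_all add: fps_cutoff_add fps_cutoff_diff fps_cutoff_uminus)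
qed (auto simp: fps_cutoff_add)

sublocale H: group sdp
  by (rule sdp_group)

lemma sdp_inv:
  assumes "fps_cutoff D f = f"
  shows "inv\<^bsub>sdp\<^esub> (f, k) = (fps_cutoff D (- (act (- k) * f)), - k)"
  using assms by (intro H.inv_equality) (simp_all add: fps_cutoff_add fps_cutoff_diff fps_cutoff_uminus)

lemma sdp_pow_right: "(0, 1) [^]\<^bsub>sdp\<^esub> (k :: int) = (0, k)"
proof -
  have c: "(0, 1) \<in> carrier sdp" by simp
  show ?thesis
  proof (induction k rule: int_induct[where k = 0])
    case (step1 i)
    then show ?case using H.int_pow_mult[OF c, of i 1] H.int_pow_1[OF c] by simp
  next
    case (step2 i)
    then show ?case using H.int_pow_diff[OF c, of i 1] H.int_pow_1[OF c] by (simp add: sdp_inv)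
  qed simp
qed

lemma sdp_pow_left:
  assumes f: "fps_cutoff D f = f"
  shows "(f, 0) [^]\<^bsub>sdp\<^esub> (k :: int) = (of_int k * f, 0)"
proof -
  have c: "(f, 0) \<in> carrier sdp" using f by simp
  have [simp]: "fps_cutoff D (of_int i * f) = of_int i * f" for i :: int
  proof -
    have "fps_cutoff D (of_int i * f) = of_int i * fps_cutoff D f"
      by (simp add: fps_eq_iff fps_of_int[symmetric])
    with f show ?thesis by simp
  qed
  show ?thesis
  proof (induction k rule: int_induct[where k = 0])
    case (step1 i)
    then show ?case using H.int_pow_mult[OF c, of i 1] H.int_pow_1[OF c] f
      by (simp add: fps_cutoff_add distrib_right)
  next
    case (step2 i)
    then show ?case using H.int_pow_diff[OF c, of i 1] H.int_pow_1[OF c] f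
      by (simp add: fps_cutoff_add fps_cutoff_diff sdp_inv left_diff_distrib fps_cutoff_uminus)
  qed simp
qed

end

section \<open>Universal property of the semidirect product\<close>

locale action_relations = commuting_family G \<alpha> D + unit_action D U V
  for G (structure) and \<alpha> D U V +
  fixes \<tau>
  assumes \<tau>_closed [simp]: "\<tau> \<in> carrier G"
    and \<tau>_conj: "i < D \<Longrightarrow> \<tau> \<otimes> \<alpha> i \<otimes> inv \<tau> = coeff_prod G \<alpha> D (U * fps_X ^ i)"
begin

text \<open>The homomorphism that von Dyck's theorem attaches to the relations, written directly in
  the coordinates of \<open>sdp\<close>.\<close>

definition from_sdp :: "int fps \<times> int \<Rightarrow> 'a" where
  "from_sdp p = coeff_prod G \<alpha> D (fst p) \<otimes> \<tau> [^] snd p"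

lemma \<tau>_conj_coeff_prod: "\<tau> \<otimes> coeff_prod G \<alpha> D f \<otimes> inv \<tau> = coeff_prod G \<alpha> D (U * f)"
proof -
  \<comment> \<open>Conjugation is a homomorphism, so each stage of the induction needs the defining
    relation only for the one monomial that is added.\<close>
  have *: "\<tau> \<otimes> coeff_prod G \<alpha> n f \<otimes> inv \<tau> = coeff_prod G \<alpha> D (U * fps_cutoff n f)"
    if "n \<le> D" for n
    using that
  proof (induction n)
    case 0
    then show ?case by (simp add: coeff_prod_zero)
  next
    case (Suc n)
    let ?c = "\<lambda>x. \<tau> \<otimes> x \<otimes> inv \<tau>"
    have "?c (coeff_prod G \<alpha> (Suc n) f) = ?c (coeff_prod G \<alpha> n f) \<otimes> ?c (\<alpha> n [^] (f $ n))"
      using hom_mult[OF conj_hom[OF \<tau>_closed], of "coeff_prod G \<alpha> n f" "\<alpha> n [^] (f $ n)"] Suc.prems by simp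
    also have "?c (\<alpha> n [^] (f $ n)) = ?c (\<alpha> n) [^] (f $ n)"
      using hom_int_pow[OF conj_hom[OF \<tau>_closed] _ is_group is_group, of "\<alpha> n" "f $ n"] Suc.prems by simp
    also have "\<dots> = coeff_prod G \<alpha> D (of_int (f $ n) * (U * fps_X ^ n))"
      using Suc.prems by (simp add: \<tau>_conj coeff_prod_of_int)
    also have "?c (coeff_prod G \<alpha> n f) = coeff_prod G \<alpha> D (U * fps_cutoff n f)"
      using Suc by simp
    also have "coeff_prod G \<alpha> D (U * fps_cutoff n f) \<otimes>
        coeff_prod G \<alpha> D (of_int (f $ n) * (U * fps_X ^ n)) =
        coeff_prod G \<alpha> D (U * fps_cutoff n f + of_int (f $ n) * (U * fps_X ^ n))"
      by (simp add: coeff_prod_add)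
    also have "U * fps_cutoff n f + of_int (f $ n) * (U * fps_X ^ n) =
        U * (fps_cutoff n f + of_int (f $ n) * fps_X ^ n)"
      by (simp add: algebra_simps)
    also have "fps_cutoff n f + of_int (f $ n) * fps_X ^ n = fps_cutoff (Suc n) f"
      by (auto simp: fps_eq_iff fps_of_int[symmetric] less_Suc_eq)
    finally show ?case .
  qed
  show ?thesis
    \<comment> \<open>\<open>coeff_prod\<close> reads only coefficients below \<open>D\<close>, and
      these do not see the truncation of the second factor.\<close>
    unfolding *[OF order_refl]
    by (intro coeff_prod_cong) (simp add: fps_cutoff_right_mult_nth)
qed

lemma \<tau>_pow_coeff_prod:
  "\<tau> [^] (k :: int) \<otimes> coeff_prod G \<alpha> D f = coeff_prod G \<alpha> D (act k * f) \<otimes> \<tau> [^] k"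
proof -
  have 1: "\<tau> \<otimes> coeff_prod G \<alpha> D f = coeff_prod G \<alpha> D (U * f) \<otimes> \<tau>" for f
    using \<tau>_conj_coeff_prod[of f] by (metis \<tau>_closed coeff_prod_closed inv_solve_right' m_closed order_refl)
  \<comment> \<open>The relations prescribe conjugation by \<open>\<tau>\<close> only; conjugation
    by its inverse follows by applying them to \<open>V * f\<close>, as
    \<open>U * V = 1\<close>.\<close>
  have 2: "inv \<tau> \<otimes> coeff_prod G \<alpha> D f = coeff_prod G \<alpha> D (V * f) \<otimes> inv \<tau>" for f
  proof -
    have "coeff_prod G \<alpha> D f = \<tau> \<otimes> coeff_prod G \<alpha> D (V * f) \<otimes> inv \<tau>"
      using \<tau>_conj_coeff_prod[of "V * f"] UV by (simp add: mult.assoc[symmetric])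
    then show ?thesis by (simp add: m_assoc inv_solve_left')
  qed
  show ?thesis
  proof (induction k rule: int_induct[where k = 0])
    case (step1 i)
    have "\<tau> [^] (i + 1) \<otimes> coeff_prod G \<alpha> D f = \<tau> \<otimes> (\<tau> [^] i \<otimes> coeff_prod G \<alpha> D f)"
      using int_pow_mult[OF \<tau>_closed, of 1 i] by (simp add: m_assoc add.commute)
    also have "\<dots> = coeff_prod G \<alpha> D (U * (act i * f)) \<otimes> (\<tau> \<otimes> \<tau> [^] i)"
      using step1 1 by (simp add: m_assoc[symmetric])
    also have "\<tau> \<otimes> \<tau> [^] i = \<tau> [^] (i + 1)"
      using int_pow_mult[OF \<tau>_closed, of 1 i] by (simp add: add.commute)
    finally show ?case by (simp add: act_Suc mult.assoc)
  next
    case (step2 i)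
    have *: "inv \<tau> \<otimes> \<tau> [^] i = \<tau> [^] (i - 1)"
      using int_pow_mult[OF \<tau>_closed, of "- 1" i] by (simp add: int_pow_neg)
    have "\<tau> [^] (i - 1) \<otimes> coeff_prod G \<alpha> D f = inv \<tau> \<otimes> (\<tau> [^] i \<otimes> coeff_prod G \<alpha> D f)"
      using * by (simp add: m_assoc[symmetric])
    also have "\<dots> = coeff_prod G \<alpha> D (V * (act i * f)) \<otimes> (inv \<tau> \<otimes> \<tau> [^] i)"
      using step2 2 by (simp add: m_assoc[symmetric])
    finally show ?case using * by (simp add: act_pred mult.assoc)
  qed simp
qed

lemma from_sdp_hom: "from_sdp \<in> hom sdp G"
proof (rule homI)
  fix p q assume "p \<in> carrier sdp" "q \<in> carrier sdp"
  obtain f k g l where pq: "p = (f, k)" "q = (g, l)" by (cases p; cases q)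
  let ?A = "coeff_prod G \<alpha> D"
  have "?A f \<otimes> \<tau> [^] k \<otimes> (?A g \<otimes> \<tau> [^] l) = ?A f \<otimes> (\<tau> [^] k \<otimes> ?A g) \<otimes> \<tau> [^] l"
    by (simp add: m_assoc)
  also have "\<dots> = ?A f \<otimes> ?A (act k * g) \<otimes> (\<tau> [^] k \<otimes> \<tau> [^] l)"
    by (simp add: \<tau>_pow_coeff_prod m_assoc)
  also have "\<dots> = ?A (f + act k * g) \<otimes> \<tau> [^] (k + l)"
    by (simp add: coeff_prod_add int_pow_mult)
  also have "?A (f + act k * g) = ?A (fps_cutoff D (f + act k * g))"
    by (intro coeff_prod_cong) simp
  finally show "from_sdp (p \<otimes>\<^bsub>sdp\<^esub> q) = from_sdp p \<otimes> from_sdp q"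
    by (simp add: pq from_sdp_def)
qed (simp add: from_sdp_def)

end

section \<open>Finite presentations\<close>

definition letter_pow :: "nat \<Rightarrow> int \<Rightarrow> nat gword" where
  "letter_pow i e = replicate (nat \<bar>e\<bar>) (i, 0 \<le> e)"

primrec coeff_word :: "nat \<Rightarrow> int fps \<Rightarrow> nat gword" where
  "coeff_word 0 f = []"
| "coeff_word (Suc n) f = coeff_word n f @ letter_pow n (f $ n)"

lemma letter_pow_gwords: "i \<in> X \<Longrightarrow> letter_pow i e \<in> gwords X"
  by (auto simp: letter_pow_def gwords_def)

lemma coeff_word_gwords: "{..<n} \<subseteq> X \<Longrightarrow> coeff_word n f \<in> gwords X"
  by (induction n) (auto simp: letter_pow_gwords lessThan_Suc)

lemma map_gwords: "w \<in> gwords X \<Longrightarrow> \<alpha> ` X \<subseteq> S \<Longrightarrow> map (apfst \<alpha>) w \<in> gwords S"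
  by (fastforce simp: gwords_def image_subset_iff)

context group
begin

lemma word_val_map_closed:
  assumes "\<alpha> ` X \<subseteq> carrier G" "w \<in> gwords X"
  shows "word_val G (map (apfst \<alpha>) w) \<in> carrier G"
  using word_val_closed[OF subset_refl map_gwords[OF assms(2,1)]] .

lemma word_val_map_append:
  assumes "\<alpha> ` X \<subseteq> carrier G" "u \<in> gwords X" "v \<in> gwords X"
  shows "word_val G (map (apfst \<alpha>) (u @ v)) =
    word_val G (map (apfst \<alpha>) u) \<otimes> word_val G (map (apfst \<alpha>) v)"
  using word_val_append[OF subset_refl map_gwords[OF assms(2,1)] map_gwords[OF assms(3,1)]]
  by simp

lemma word_val_letter_pow:
  assumes "\<alpha> i \<in> carrier G"
  shows "word_val G (map (apfst \<alpha>) (letter_pow i e)) = \<alpha> i [^] e"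
proof -
  have *: "word_val G (replicate n (\<alpha> i, b)) = (if b then \<alpha> i else inv \<alpha> i) [^] n" for n b
  proof (induction n)
    case (Suc n)
    then show ?case using assms nat_pow_Suc2[of "if b then \<alpha> i else inv \<alpha> i" n] by simp
  qed simp
  have "(\<alpha> i) [^] e = (if 0 \<le> e then \<alpha> i else inv \<alpha> i) [^] nat \<bar>e\<bar>"
    using assms by (subst int_pow_def2) (auto simp: int_pow_inv)
  then show ?thesis by (simp add: letter_pow_def *)
qed

lemma word_val_coeff_word:
  assumes "\<alpha> ` {..<n} \<subseteq> carrier G"
  shows "word_val G (map (apfst \<alpha>) (coeff_word n f)) = coeff_prod G \<alpha> n f"
  using assms
proof (induction n)
  case (Suc n)
  have "word_val G (map (apfst \<alpha>) (coeff_word n f @ letter_pow n (f $ n))) =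
      word_val G (map (apfst \<alpha>) (coeff_word n f)) \<otimes> word_val G (map (apfst \<alpha>) (letter_pow n (f $ n)))"
    by (intro word_val_map_append[OF Suc.prems] coeff_word_gwords letter_pow_gwords) auto
  moreover have "\<alpha> n \<in> carrier G" "\<alpha> ` {..<n} \<subseteq> carrier G" using Suc.prems by auto
  ultimately show ?case using Suc.IH by (simp add: word_val_letter_pow)
qed simp

text \<open>Von Dyck's theorem on the level of words: cancellations and relator insertions leave the
  value unchanged in any group where the relators hold.\<close>

lemma pres_eq_word_val:
  assumes "\<alpha> ` X \<subseteq> carrier G" "R \<subseteq> gwords X"
    and rel: "\<And>r. r \<in> R \<Longrightarrow> word_val G (map (apfst \<alpha>) r) = \<one>"
    and "pres_eq X R u v"
  shows "word_val G (map (apfst \<alpha>) u) = word_val G (map (apfst \<alpha>) v)"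
  using assms(4)
proof induction
  case (pres_cancel u v x b)
  have x: "\<alpha> x \<in> carrier G" using assms(1) pres_cancel by auto
  have "word_val G (map (apfst \<alpha>) ([(x, b), (x, \<not> b)] @ v)) = word_val G (map (apfst \<alpha>) v)"
    using x word_val_map_closed[OF assms(1) pres_cancel(2)] by (simp add: m_assoc[symmetric])
  then show ?case
    using word_val_map_append[OF assms(1), of u "[(x, b), (x, \<not> b)] @ v"]
      word_val_map_append[OF assms(1), of u v] pres_cancel by simp
next
  case (pres_rel u v r)
  then have "r \<in> gwords X" using assms(2) by auto
  then show ?case
    using word_val_map_append[OF assms(1), of u "r @ v"] word_val_map_append[OF assms(1), of r v]
      word_val_map_append[OF assms(1), of u v] pres_rel rel word_val_map_closed[OF assms(1)] by simp
qed auto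

end

text \<open>Makes \<open>word_val\<close> available inside the presented group, where a relator then
  becomes an equation between the classes of the letters.\<close>

lemma pres_class_word_val:
  assumes "R \<subseteq> gwords X" "w \<in> gwords X"
  shows "pres_class X R w =
    word_val (presented_group X R) (map (apfst (\<lambda>x. pres_class X R [(x, True)])) w)"
  using assms(2)
proof (induction w)
  case Nil
  then show ?case by (simp add: presented_group_def)
next
  case (Cons a w)
  interpret P: group "presented_group X R" by (rule group_presented_group[OF assms(1)])
  obtain x b where a: "a = (x, b)" by (cases a)
  have x: "x \<in> X" "w \<in> gwords X" using Cons.prems a by auto
  note m = presented_group_mult[OF assms(1)]
  have c: "pres_class X R v \<in> carrier (presented_group X R)" if "v \<in> gwords X" for v
    using that by (simp add: presented_group_def)
  have "pres_eq X R ([] @ [(x, False), (x, \<not> False)] @ []) ([] @ [])"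
    using x by (intro pres_eq.pres_cancel) auto
  then have "pres_class X R [(x, False)] \<otimes>\<^bsub>presented_group X R\<^esub> pres_class X R [(x, True)] =
      \<one>\<^bsub>presented_group X R\<^esub>"
    using x m[of "[(x, False)]" "[(x, True)]"]
      pres_class_eq_iff[of "[(x, False), (x, True)]" X R "[]"]
    by (simp add: presented_group_def)
  then have "inv\<^bsub>presented_group X R\<^esub> pres_class X R [(x, True)] = pres_class X R [(x, False)]"
    using x by (intro P.inv_equality c) auto
  then have "pres_class X R [(x, b)] =
      (if b then pres_class X R [(x, True)] else inv\<^bsub>presented_group X R\<^esub> pres_class X R [(x, True)])"
    by simp
  moreover have "pres_class X R ([(x, b)] @ w) =
      pres_class X R [(x, b)] \<otimes>\<^bsub>presented_group X R\<^esub> pres_class X R w"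
    using x by (intro m[symmetric]) auto
  ultimately show ?case using Cons.IH x a by simp
qed

lemma (in commuting_family) coeff_prod_monomial:
  "n \<le> D \<Longrightarrow> coeff_prod G \<alpha> n (fps_X ^ i) = (if i < n then \<alpha> i else \<one>)"
  by (induction n) (auto simp: less_Suc_eq)

section \<open>Presentation of the semidirect product\<close>

context unit_action
begin

text \<open>The letters \<open>i < D\<close> stand for the monomials \<open>fps_X ^ i\<close>, the letter \<open>D\<close> for the generator of the
  infinite cyclic factor.\<close>

definition sdp_relators :: "nat gword set" where
  "sdp_relators =
    (\<lambda>(i, j). [(i, True), (j, True), (i, False), (j, False)]) ` ({..<D} \<times> {..<D}) \<union>
    (\<lambda>i. [(D, True), (i, True), (D, False)] @ coeff_word D (- (U * fps_X ^ i))) ` {..<D}"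

abbreviation sdp_presented :: "nat gword set monoid" where
  "sdp_presented \<equiv> presented_group {..D} sdp_relators"

lemma sdp_relators_gwords: "sdp_relators \<subseteq> gwords {..D}"
  by (auto simp: sdp_relators_def intro!: coeff_word_gwords)

definition sdp_gen :: "nat \<Rightarrow> int fps \<times> int" where
  "sdp_gen i = (if i < D then (fps_X ^ i, 0) else (0, 1))"

lemma cutoff_X_power: "i < n \<Longrightarrow> fps_cutoff n (fps_X ^ i :: int fps) = fps_X ^ i"
  by (auto simp: fps_eq_iff)

lemma sdp_gen_closed: "sdp_gen ` X \<subseteq> carrier sdp"
  by (auto simp: sdp_gen_def cutoff_X_power)

lemma sdp_gen_coeff_prod: "n \<le> D \<Longrightarrow> coeff_prod sdp sdp_gen n f = (fps_cutoff n f, 0)"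
proof (induction n)
  case (Suc n)
  have "fps_cutoff D (fps_cutoff n f + of_int (f $ n) * fps_X ^ n) = fps_cutoff (Suc n) f"
    using Suc.prems by (auto simp: fps_eq_iff fps_of_int[symmetric] less_Suc_eq)
  then show ?case
    using Suc by (simp add: sdp_gen_def sdp_pow_left cutoff_X_power)
qed simp

lemma sdp_gen_relators:
  assumes "r \<in> sdp_relators"
  shows "word_val sdp (map (apfst sdp_gen) r) = \<one>\<^bsub>sdp\<^esub>"
proof -
  note gen = sdp_gen_closed[of "{..D}"] sdp_gen_closed[of "{..<D}"]
  from assms consider i j where "i < D" "j < D" "r = [(i, True), (j, True), (i, False), (j, False)]"
    | i where "i < D" "r = [(D, True), (i, True), (D, False)] @ coeff_word D (- (U * fps_X ^ i))"
    unfolding sdp_relators_def by auto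
  then show ?thesis
  proof cases
    case 1
    then show ?thesis
      by (simp add: sdp_gen_def sdp_inv cutoff_X_power fps_cutoff_add fps_cutoff_diff fps_cutoff_uminus)
  next
    case 2
    have "word_val sdp (map (apfst sdp_gen) (coeff_word D (- (U * fps_X ^ i)))) =
        (- fps_cutoff D (U * fps_X ^ i), 0)"
      by (simp add: H.word_val_coeff_word[OF gen(2)] sdp_gen_coeff_prod fps_cutoff_uminus)
    moreover have "fps_cutoff D (U * (V * g)) = fps_cutoff D g" for g
      using UV by (simp add: mult.assoc[symmetric])
    ultimately show ?thesis
      using 2 by (simp add: sdp_gen_def sdp_inv act_def fps_cutoff_add fps_cutoff_diff fps_cutoff_uminus
          cutoff_X_power right_diff_distrib distrib_left)
  qed
qed

text \<open>Each relator has the form u v^-1 with u = v the desired relation, so its triviality is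
  solved for u.\<close>

lemma action_relations_presented:
  "action_relations sdp_presented (\<lambda>i. pres_class {..D} sdp_relators [(i, True)]) D U V
    (pres_class {..D} sdp_relators [(D, True)])"
proof -
  let ?P = sdp_presented
  let ?\<alpha> = "\<lambda>i. pres_class {..D} sdp_relators [(i, True)]"
  interpret P: group ?P by (rule group_presented_group[OF sdp_relators_gwords])
  have c: "?\<alpha> i \<in> carrier ?P" if "i \<le> D" for i
    using that by (simp add: presented_group_def)
  have one: "\<one>\<^bsub>?P\<^esub> = pres_class {..D} sdp_relators []"
    by (simp add: presented_group_def)
  have rel: "word_val ?P (map (apfst ?\<alpha>) r) = \<one>\<^bsub>?P\<^esub>" if "r \<in> sdp_relators" for r
  proof -
    have r: "r \<in> gwords {..D}" using that sdp_relators_gwords by auto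
    have "pres_eq {..D} sdp_relators ([] @ r @ []) ([] @ [])"
      using that by (intro pres_eq.pres_rel) auto
    then have "pres_class {..D} sdp_relators r = pres_class {..D} sdp_relators []"
      using pres_class_eq_iff[OF r] by simp
    then show ?thesis
      unfolding one pres_class_word_val[OF sdp_relators_gwords r] .
  qed
  interpret C: commuting_family ?P ?\<alpha> D
  proof unfold_locales
    fix i j assume ij: "i < D" "j < D"
    then have "[(i, True), (j, True), (i, False), (j, False)] \<in> sdp_relators"
      by (auto simp: sdp_relators_def)
    from rel[OF this] have "(?\<alpha> i \<otimes>\<^bsub>?P\<^esub> ?\<alpha> j) \<otimes>\<^bsub>?P\<^esub> inv\<^bsub>?P\<^esub> (?\<alpha> j \<otimes>\<^bsub>?P\<^esub> ?\<alpha> i) = \<one>\<^bsub>?P\<^esub>"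
      using ij c by (simp add: P.m_assoc P.inv_mult_group)
    then show "?\<alpha> i \<otimes>\<^bsub>?P\<^esub> ?\<alpha> j = ?\<alpha> j \<otimes>\<^bsub>?P\<^esub> ?\<alpha> i"
      using ij c P.inv_solve_right'[of "\<one>\<^bsub>?P\<^esub>" "?\<alpha> i \<otimes>\<^bsub>?P\<^esub> ?\<alpha> j" "?\<alpha> j \<otimes>\<^bsub>?P\<^esub> ?\<alpha> i"] by simp
  qed (use c in auto)
  show ?thesis
  proof unfold_locales
    show "?\<alpha> D \<in> carrier ?P" using c by simp
    fix i assume i: "i < D"
    then have "[(D, True), (i, True), (D, False)] @ coeff_word D (- (U * fps_X ^ i)) \<in> sdp_relators"
      by (auto simp: sdp_relators_def)
    from rel[OF this]
    have "?\<alpha> D \<otimes>\<^bsub>?P\<^esub> ?\<alpha> i \<otimes>\<^bsub>?P\<^esub> inv\<^bsub>?P\<^esub> ?\<alpha> D \<otimes>\<^bsub>?P\<^esub> inv\<^bsub>?P\<^esub> (coeff_prod ?P ?\<alpha> D (U * fps_X ^ i)) =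
        \<one>\<^bsub>?P\<^esub>"
      using i c by (simp add: P.word_val_coeff_word image_subset_iff C.coeff_prod_uminus P.m_assoc)
    then show "?\<alpha> D \<otimes>\<^bsub>?P\<^esub> ?\<alpha> i \<otimes>\<^bsub>?P\<^esub> inv\<^bsub>?P\<^esub> ?\<alpha> D = coeff_prod ?P ?\<alpha> D (U * fps_X ^ i)"
      using i c P.inv_solve_right'[of "\<one>\<^bsub>?P\<^esub>" "?\<alpha> D \<otimes>\<^bsub>?P\<^esub> ?\<alpha> i \<otimes>\<^bsub>?P\<^esub> inv\<^bsub>?P\<^esub> ?\<alpha> D"
          "coeff_prod ?P ?\<alpha> D (U * fps_X ^ i)"] by simp
  qed
qed

text \<open>Injectivity: if two pairs have the same image, their normal form words \<open>nf\<close>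
  are equal in the presentation, and evaluating these words back in \<open>sdp\<close> recovers the
  pairs. Surjectivity: every letter lies in the image. No rewriting of words to normal form takes
  place.\<close>

lemma sdp_iso_presented: "\<exists>h. h \<in> iso sdp sdp_presented"
proof -
  let ?P = sdp_presented
  define \<alpha> where "\<alpha> = (\<lambda>i. pres_class {..D} sdp_relators [(i, True)])"
  interpret P: action_relations ?P \<alpha> D U V "\<alpha> D"
    unfolding \<alpha>_def by (rule action_relations_presented)
  note R = sdp_relators_gwords
  note cls = pres_class_word_val[OF R, folded \<alpha>_def]
  have c: "\<alpha> ` {..D} \<subseteq> carrier ?P"
    by (auto simp: \<alpha>_def presented_group_def)
  then have c': "\<alpha> ` {..<D} \<subseteq> carrier ?P" by auto
  define nf where "nf = (\<lambda>(f, k). coeff_word D f @ letter_pow D k)"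
  have nf: "nf p \<in> gwords {..D}" for p
    unfolding nf_def by (cases p) (auto intro!: coeff_word_gwords letter_pow_gwords)
  have nf_P: "word_val ?P (map (apfst \<alpha>) (nf p)) = P.from_sdp p" for p
  proof -
    have "word_val ?P (map (apfst \<alpha>) (nf p)) = word_val ?P (map (apfst \<alpha>) (coeff_word D (fst p)))
        \<otimes>\<^bsub>?P\<^esub> word_val ?P (map (apfst \<alpha>) (letter_pow D (snd p)))"
      unfolding nf_def case_prod_beta
      by (intro P.word_val_map_append[OF c] coeff_word_gwords letter_pow_gwords) auto
    then show ?thesis
      by (simp add: P.word_val_coeff_word[OF c'] P.word_val_letter_pow P.from_sdp_def)
  qed
  have nf_H: "word_val sdp (map (apfst sdp_gen) (nf p)) = p" if "p \<in> carrier sdp" for p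
  proof -
    note gen = sdp_gen_closed[of "{..D}"] sdp_gen_closed[of "{..<D}"]
    have "word_val sdp (map (apfst sdp_gen) (nf p)) =
        word_val sdp (map (apfst sdp_gen) (coeff_word D (fst p)))
        \<otimes>\<^bsub>sdp\<^esub> word_val sdp (map (apfst sdp_gen) (letter_pow D (snd p)))"
      unfolding nf_def case_prod_beta
      by (intro H.word_val_map_append[OF gen(1)] coeff_word_gwords letter_pow_gwords) auto
    also have "\<dots> = (fps_cutoff D (fst p), 0) \<otimes>\<^bsub>sdp\<^esub> (0, snd p)"
      using gen(1) by (simp add: H.word_val_coeff_word[OF gen(2)] sdp_gen_coeff_prod
          H.word_val_letter_pow image_subset_iff) (simp add: sdp_gen_def sdp_pow_right)
    finally show ?thesis using that by (cases p) simp
  qed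
  have gen: "P.from_sdp (sdp_gen i) = \<alpha> i" if "i \<le> D" for i
    using that c by (auto simp: P.from_sdp_def sdp_gen_def P.coeff_prod_monomial P.coeff_prod_zero)
  have "inj_on P.from_sdp (carrier sdp)"
  proof (rule inj_onI)
    fix p q assume pq: "p \<in> carrier sdp" "q \<in> carrier sdp" "P.from_sdp p = P.from_sdp q"
    then have "pres_class {..D} sdp_relators (nf p) = pres_class {..D} sdp_relators (nf q)"
      by (simp add: cls[OF nf] nf_P)
    then have "pres_eq {..D} sdp_relators (nf p) (nf q)"
      using pres_class_eq_iff[OF nf] by blast
    from H.pres_eq_word_val[OF sdp_gen_closed R sdp_gen_relators this]
    show "p = q" by (simp add: nf_H pq)
  qed
  moreover have "carrier ?P \<subseteq> P.from_sdp ` carrier sdp"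
  proof
    fix x assume "x \<in> carrier ?P"
    then obtain w where w: "w \<in> gwords {..D}" "x = pres_class {..D} sdp_relators w"
      by (auto simp: presented_group_def)
    have "map (apfst \<alpha>) w = map (apfst P.from_sdp) (map (apfst sdp_gen) w)"
      using w(1) gen by (auto simp: gwords_def)
    moreover have "word_val ?P (map (apfst P.from_sdp) (map (apfst sdp_gen) w)) =
        P.from_sdp (word_val sdp (map (apfst sdp_gen) w))"
      by (rule word_val_hom[OF sdp_group P.is_group P.from_sdp_hom subset_refl
          map_gwords[OF w(1) sdp_gen_closed]])
    ultimately have "x = P.from_sdp (word_val sdp (map (apfst sdp_gen) w))"
      by (simp only: w(2) cls[OF w(1)])
    then show "x \<in> P.from_sdp ` carrier sdp"
      using H.word_val_map_closed[OF sdp_gen_closed w(1)] by blast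
  qed
  ultimately have "bij_betw P.from_sdp (carrier sdp) (carrier ?P)"
    using P.from_sdp_hom by (auto simp: bij_betw_def hom_def)
  then show ?thesis
    using P.from_sdp_hom by (auto simp: iso_def)
qed

lemma finitely_presented_sdp: "finitely_presented sdp_presented"
  unfolding finitely_presented_def
proof (intro exI conjI)
  show "finite sdp_relators" by (simp add: sdp_relators_def)
  show "sdp_presented \<cong> sdp_presented" by (rule iso_refl)
qed (use sdp_relators_gwords in auto)

text \<open>Pulling a generating set back along the isomorphism reduces the claim for the presented
  group to all finite generating sets of \<open>sdp\<close>.\<close>

lemma CL_presented_eqI:
  assumes "\<And>S. finite S \<Longrightarrow> S \<subseteq> carrier sdp \<Longrightarrow> generate sdp S = carrier sdp \<Longrightarrow>
      CL sdp S \<simeq> F"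
    and S: "finite S" "S \<subseteq> carrier sdp_presented"
      "generate sdp_presented S = carrier sdp_presented"
  shows "CL sdp_presented S \<simeq> F"
proof -
  obtain h where h: "h \<in> iso sdp sdp_presented" using sdp_iso_presented by blast
  have P: "group sdp_presented" by (rule group_presented_group[OF sdp_relators_gwords])
  define g where "g = inv_into (carrier sdp) h"
  have g: "g \<in> iso sdp_presented sdp"
    unfolding g_def by (rule H.iso_set_sym[OF h])
  then have hom: "group_hom sdp_presented sdp g"
    using P sdp_group by (auto simp: group_hom_def group_hom_axioms_def iso_def)
  have bij: "g ` carrier sdp_presented = carrier sdp"
    using g by (auto simp: iso_def bij_betw_def)
  have "CL sdp (g ` S) \<simeq> F"
  proof (rule assms(1))
    show "generate sdp (g ` S) = carrier sdp"
      using group_hom.generate_img[OF hom S(2)] S(3) bij by simp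
  qed (use S bij in auto)
  moreover have "CL sdp (g ` S) = CL sdp_presented S"
    using CL_iso[OF P sdp_group g S(2)] by auto
  ultimately show ?thesis by simp
qed

end

section \<open>Coefficient growth\<close>

text \<open>The binomial theorem with every binomial coefficient lowered to 1.\<close>

lemma sum_pow_mult_le: "(\<Sum>j=0..i. a ^ j * b ^ (i - j)) \<le> (a + b :: nat) ^ i"
proof -
  have "(\<Sum>j=0..i. a ^ j * b ^ (i - j)) \<le> (\<Sum>j\<le>i. (i choose j) * a ^ j * b ^ (i - j))"
    unfolding atLeast0AtMost
  proof (rule sum_mono)
    fix j assume "j \<in> {..i}"
    then have "1 \<le> i choose j" by (simp add: Suc_leI)
    then have "1 * (a ^ j * b ^ (i - j)) \<le> (i choose j) * (a ^ j * b ^ (i - j))"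
      by (rule mult_right_mono) simp
    then show "a ^ j * b ^ (i - j) \<le> (i choose j) * a ^ j * b ^ (i - j)"
      by (simp add: mult.assoc)
  qed
  then show ?thesis by (simp add: binomial)
qed

text \<open>Coefficientwise domination by the expansion of M / (1 - a X). With M and a linear in n
  it says that coefficient i is O(n^(i+1)). Since 0^0 = 1, rate a = 0 allows a nonzero constant term
  only.\<close>

definition majorized :: "nat \<Rightarrow> nat \<Rightarrow> int fps \<Rightarrow> bool" where
  "majorized M a f \<longleftrightarrow> (\<forall>i. \<bar>f $ i\<bar> \<le> int (M * a ^ i))"

lemma majorizedD: "majorized M a f \<Longrightarrow> \<bar>f $ i\<bar> \<le> int (M * a ^ i)"
  by (simp add: majorized_def)

lemma majorized_mono:
  assumes "majorized M a f" "M \<le> N" "a \<le> b"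
  shows "majorized N b f"
  unfolding majorized_def
proof
  fix i
  have "M * a ^ i \<le> N * b ^ i" using assms(2,3) by (intro mult_mono power_mono) auto
  then show "\<bar>f $ i\<bar> \<le> int (N * b ^ i)"
    using majorizedD[OF assms(1), of i] by linarith
qed

lemma majorized_add:
  assumes "majorized M a f" "majorized N a g"
  shows "majorized (M + N) a (f + g)"
  unfolding majorized_def
proof
  fix i
  have "\<bar>(f + g) $ i\<bar> \<le> \<bar>f $ i\<bar> + \<bar>g $ i\<bar>" by simp
  also have "\<dots> \<le> int (M * a ^ i) + int (N * a ^ i)"
    by (intro add_mono majorizedD assms)
  finally show "\<bar>(f + g) $ i\<bar> \<le> int ((M + N) * a ^ i)"
    by (simp add: distrib_right)
qed

lemma majorized_uminus: "majorized M a f \<Longrightarrow> majorized M a (- f)"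
  by (simp add: majorized_def)

lemma majorized_cutoff: "majorized M a f \<Longrightarrow> majorized M a (fps_cutoff n f)"
  by (simp add: majorized_def)

text \<open>The dominating series multiply to coefficients M N times the sum of a^j b^(i-j), at most
  M N (a + b)^i. Rates add while factors multiply, so series with factor 1 can be multiplied
  repeatedly at the cost of the rate alone.\<close>

lemma majorized_mult:
  assumes "majorized M a f" "majorized N b g"
  shows "majorized (M * N) (a + b) (f * g)"
  unfolding majorized_def
proof
  fix i
  have "\<bar>(f * g) $ i\<bar> \<le> (\<Sum>j=0..i. \<bar>f $ j\<bar> * \<bar>g $ (i - j)\<bar>)"
    unfolding fps_mult_nth by (rule order_trans[OF sum_abs]) (simp add: abs_mult)
  also have "\<dots> \<le> (\<Sum>j=0..i. int (M * a ^ j) * int (N * b ^ (i - j)))"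
    by (intro sum_mono mult_mono majorizedD assms) auto
  also have "\<dots> = int (M * N * (\<Sum>j=0..i. a ^ j * b ^ (i - j)))"
    by (simp add: sum_distrib_left mult_ac)
  also have "\<dots> \<le> int (M * N * (a + b) ^ i)"
    using sum_pow_mult_le[of a b i] by (intro of_nat_mono mult_left_mono) auto
  finally show "\<bar>(f * g) $ i\<bar> \<le> int (M * N * (a + b) ^ i)" .
qed

lemma majorized_one: "majorized 1 a 1"
  by (simp add: majorized_def)

lemma majorized_power: "majorized 1 1 f \<Longrightarrow> majorized 1 n (f ^ n)"
proof (induction n)
  case (Suc n)
  then show ?case using majorized_mult[of 1 1 f 1 n "f ^ n"] by simp
qed (use majorized_one in simp)

lemma majorized_const_exists:
  assumes "fps_cutoff n f = f"
  shows "\<exists>M. majorized M 1 f"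
proof -
  have "\<bar>f $ i\<bar> \<le> int (\<Sum>j<n. nat \<bar>f $ j\<bar>)" for i
  proof (cases "i < n")
    case True
    then have "nat \<bar>f $ i\<bar> \<le> (\<Sum>j<n. nat \<bar>f $ j\<bar>)"
      by (intro member_le_sum) auto
    then show ?thesis by linarith
  next
    case False
    then have "f $ i = 0" using assms by (metis fps_cutoff_nth)
    then show ?thesis by simp
  qed
  then have "majorized (\<Sum>j<n. nat \<bar>f $ j\<bar>) 1 f" by (simp add: majorized_def)
  then show ?thesis by blast
qed

context unit_action
begin

lemma sdp_snd_mult [simp]: "snd (p \<otimes>\<^bsub>sdp\<^esub> q) = snd p + snd q"
  by (cases p; cases q) simp

lemma sdp_snd_pow:
  assumes "p \<in> carrier sdp"
  shows "snd (p [^]\<^bsub>sdp\<^esub> (j :: int)) = j * snd p"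
proof (induction j rule: int_induct[where k = 0])
  case (step1 i)
  then show ?case using H.int_pow_mult[OF assms, of i 1] assms by (simp add: distrib_right)
next
  case (step2 i)
  have "snd (inv\<^bsub>sdp\<^esub> p) = - snd p" using assms by (cases p) (simp add: sdp_inv)
  then show ?case
    using step2 H.int_pow_diff[OF assms, of i 1] assms by (simp add: left_diff_distrib)
qed simp

lemma sdp_conj_iff:
  "(a, k) \<otimes>\<^bsub>sdp\<^esub> (c, m) = (c, m) \<otimes>\<^bsub>sdp\<^esub> (b, l) \<longleftrightarrow>
    k = l \<and> fps_cutoff D ((1 - act k) * c) = fps_cutoff D (a - act m * b)"
  by (auto simp: fps_cutoff_add fps_cutoff_diff algebra_simps)

end

section \<open>Word length and conjugator length in the semidirect product\<close>

locale majorized_action = unit_action +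
  assumes majorized_U: "majorized 1 1 U" and majorized_V: "majorized 1 1 V"
begin

lemma majorized_act: "majorized 1 (nat \<bar>k\<bar>) (act k)"
  using majorized_power[OF majorized_U, of "nat k"] majorized_power[OF majorized_V, of "nat (- k)"]
  by (auto simp: act_def)

end

locale sdp_generators = majorized_action D U V + group_subset sdp S for D U V and S +
  assumes finite_S: "finite S" and S_generates: "generate sdp S = carrier sdp"
begin

lemma finite_majorized:
  assumes "finite A" "A \<subseteq> carrier sdp"
  shows "\<exists>c. \<forall>(f, k)\<in>A. \<bar>k\<bar> \<le> int c \<and> majorized c 1 f"
  using assms
proof (induction A)
  case (insert p A)
  obtain f k where p: "p = (f, k)" by (cases p)
  obtain c where c: "\<forall>(f, k)\<in>A. \<bar>k\<bar> \<le> int c \<and> majorized c 1 f" using insert by auto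
  obtain M where M: "majorized M 1 f"
    using majorized_const_exists[of D f] insert.prems p by auto
  show ?case
    using M c p by (intro exI[of _ "c + M + nat \<bar>k\<bar>"]) (fastforce intro: majorized_mono)
qed simp

text \<open>Prepending a letter (f, k) multiplies the module coordinate by \<open>act k\<close>,
  which raises the rate by |k| <= c, and adds f, which raises the factor by c. The summand 1 in the
  rate accommodates f itself, which has rate 1.\<close>

lemma ball_majorized:
  "\<exists>c. \<forall>n f k. (f, k) \<in> word_ball sdp S n \<longrightarrow> \<bar>k\<bar> \<le> int (c * n) \<and> majorized (c * n) (c * n + 1) f"
proof -
  obtain c where c: "\<And>f k. (f, k) \<in> S \<union> m_inv sdp ` S \<Longrightarrow> \<bar>k\<bar> \<le> int c \<and> majorized c 1 f"
    using finite_majorized[of "S \<union> m_inv sdp ` S"] finite_S S_carrier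
    by (fastforce simp: image_subset_iff)
  have *: "\<bar>snd (word_val sdp w)\<bar> \<le> int (c * length w) \<and>
      majorized (c * length w) (c * length w + 1) (fst (word_val sdp w))" if "w \<in> gwords S" for w
    using that
  proof (induction w)
    case Nil
    then show ?case by (simp add: majorized_def)
  next
    case (Cons a w)
    obtain x b where a: "a = (x, b)" by (cases a)
    obtain f k where fk: "(if b then x else inv\<^bsub>sdp\<^esub> x) = (f, k)" by fastforce
    obtain g l where gl: "word_val sdp w = (g, l)" by fastforce
    have "(f, k) \<in> S \<union> m_inv sdp ` S"
      unfolding fk[symmetric] using Cons.prems a by auto
    then have k: "\<bar>k\<bar> \<le> int c" and f: "majorized c 1 f" using c by auto
    have l: "\<bar>l\<bar> \<le> int (c * length w)"
      and g: "majorized (c * length w) (c * length w + 1) g"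
      using Cons gl a by auto
    have "majorized (1 * (c * length w)) (nat \<bar>k\<bar> + (c * length w + 1)) (act k * g)"
      by (intro majorized_mult majorized_act g)
    then have "majorized (c * length w) (c * length (a # w) + 1) (act k * g)"
      using k by (elim majorized_mono) auto
    moreover have "majorized c (c * length (a # w) + 1) f"
      using f by (elim majorized_mono) auto
    ultimately have "majorized (c * length (a # w)) (c * length (a # w) + 1) (f + act k * g)"
      using majorized_add[of c "c * length (a # w) + 1" f "c * length w" "act k * g"] by simp
    moreover have "\<bar>k + l\<bar> \<le> int (c * length (a # w))"
      using k l by (simp add: algebra_simps)
    ultimately show ?case
      using fk gl a by (simp add: majorized_cutoff)
  qed
  have "\<bar>k\<bar> \<le> int (c * n) \<and> majorized (c * n) (c * n + 1) f"
    if fk: "(f, k) \<in> word_ball sdp S n" for n f k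
  proof -
    from fk obtain w where w: "w \<in> gwords S" "length w \<le> n" "(f, k) = word_val sdp w"
      by (elim word_ballE)
    then have 1: "\<bar>k\<bar> \<le> int (c * length w)" "majorized (c * length w) (c * length w + 1) f"
      using *[OF w(1)] by (metis snd_conv, metis fst_conv)
    have "c * length w \<le> c * n" using w by simp
    moreover have "int (c * length w) \<le> int (c * n)" using calculation by (rule of_nat_mono)
    ultimately show ?thesis
      using 1 majorized_mono[OF 1(2), of "c * n" "c * n + 1"] by linarith
  qed
  then show ?thesis by blast
qed

text \<open>The element is spelled as a product of powers of the standard generators, each of which
  is a word of bounded length over \<open>S\<close>.\<close>

lemma ball_of_coeffs:
  "\<exists>c. \<forall>f k. (f, k) \<in> carrier sdp \<longrightarrow>
    (f, k) \<in> word_ball sdp S (c * ((\<Sum>i<D. nat \<bar>f $ i\<bar>) + nat \<bar>k\<bar>))"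
proof -
  obtain c where c: "sdp_gen ` {..D} \<subseteq> word_ball sdp S c"
    using finite_generate_ball[of "sdp_gen ` {..D}"] sdp_gen_closed S_generates by auto
  have *: "coeff_prod sdp sdp_gen n f \<in> word_ball sdp S (c * (\<Sum>i<n. nat \<bar>f $ i\<bar>))"
    if "n \<le> D" for n f
    using that
  proof (induction n)
    case 0
    then show ?case using ball_one by simp
  next
    case (Suc n)
    have "sdp_gen n [^]\<^bsub>sdp\<^esub> (f $ n) \<in> word_ball sdp S (c * nat \<bar>f $ n\<bar>)"
      using c Suc.prems by (intro ball_pow) auto
    then show ?case
      using Suc ball_mult by (simp add: distrib_left)
  qed
  have "(f, k) \<in> word_ball sdp S (c * ((\<Sum>i<D. nat \<bar>f $ i\<bar>) + nat \<bar>k\<bar>))"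
    if "(f, k) \<in> carrier sdp" for f k
  proof -
    have "(f, 0) \<in> word_ball sdp S (c * (\<Sum>i<D. nat \<bar>f $ i\<bar>))"
      using *[of D f] that by (simp add: sdp_gen_coeff_prod)
    moreover have "sdp_gen D [^]\<^bsub>sdp\<^esub> k \<in> word_ball sdp S (c * nat \<bar>k\<bar>)"
      using c by (intro ball_pow) auto
    then have "(0, k) \<in> word_ball sdp S (c * nat \<bar>k\<bar>)"
      by (simp add: sdp_gen_def sdp_pow_right)
    ultimately have "(f, 0) \<otimes>\<^bsub>sdp\<^esub> (0, k) \<in>
        word_ball sdp S (c * (\<Sum>i<D. nat \<bar>f $ i\<bar>) + c * nat \<bar>k\<bar>)"
      by (rule ball_mult)
    then show ?thesis using that by (simp add: distrib_left)
  qed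
  then show ?thesis by blast
qed

text \<open>Separates the group theory from the action: \<open>trivial\<close> concerns conjugation
  within the module, where only the exponent of the conjugator matters, and
  \<open>nontrivial\<close> a linear equation for its module coordinate. Both replace a given
  solution by a small one.\<close>

lemma CL_growth_le:
  assumes d: "d \<ge> 1"
    and trivial: "\<And>q f g m. q \<ge> 1 \<Longrightarrow> majorized q q f \<Longrightarrow> majorized q q g \<Longrightarrow>
      fps_cutoff D (act m * g) = fps_cutoff D f \<Longrightarrow>
      \<exists>m'. fps_cutoff D (act m' * g) = fps_cutoff D f \<and> \<bar>m'\<bar> \<le> int (C * q ^ d)"
    and nontrivial: "\<And>q k r c. k \<noteq> 0 \<Longrightarrow> \<bar>k\<bar> \<le> int q \<Longrightarrow> majorized q q r \<Longrightarrow>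
      fps_cutoff D ((1 - act k) * c) = fps_cutoff D r \<Longrightarrow>
      \<exists>c'. fps_cutoff D ((1 - act k) * c') = fps_cutoff D r \<and> (\<forall>i<D. \<bar>c' $ i\<bar> \<le> int (C * q ^ d))"
  shows "CL sdp S \<preceq> (\<lambda>n. n ^ d)"
proof -
  obtain c where c: "\<And>n f k. (f, k) \<in> word_ball sdp S n \<Longrightarrow>
      \<bar>k\<bar> \<le> int (c * n) \<and> majorized (c * n) (c * n + 1) f"
    using ball_majorized by blast
  obtain L where L: "\<And>f k. (f, k) \<in> carrier sdp \<Longrightarrow>
      (f, k) \<in> word_ball sdp S (L * ((\<Sum>i<D. nat \<bar>f $ i\<bar>) + nat \<bar>k\<bar>))"
    using ball_of_coeffs by blast
  \<comment> \<open>\<open>D * C\<close> pays for the D coefficients of a conjugator,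
    \<open>C\<close> for its exponent when k = 0, and 1 for the exponent reduced modulo k.\<close>
  define K where "K = L * (D * C + C + 1)"
  have "CL sdp S n \<le> K * (2 * (c * n + 1)) ^ d" for n
  proof (rule CL_le[OF finite_S])
    fix x y g
    assume xy: "x \<in> word_ball sdp S n" "y \<in> word_ball sdp S n" "g \<in> carrier sdp"
      "x \<otimes>\<^bsub>sdp\<^esub> g = g \<otimes>\<^bsub>sdp\<^esub> y"
    obtain a k where x: "x = (a, k)" by (cases x)
    obtain b l where y: "y = (b, l)" by (cases y)
    obtain e m where g: "g = (e, m)" by (cases g)
    have kl: "l = k" using xy(4) x y g by simp
    have xc: "x \<in> carrier sdp" "y \<in> carrier sdp" using ball_closed xy by auto
    \<comment> \<open>The right-hand side below has factor at most 2 c n and, after acting by an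
      exponent of size at most c n, rate at most 2 c n + 1; q dominates both.\<close>
    define q where "q = 2 * (c * n + 1)"
    have q1: "q \<ge> 1" and qd: "q \<le> q ^ d" using d by (auto simp: q_def intro: self_le_power)
    have k: "\<bar>k\<bar> \<le> int (c * n)" using c xy(1) x by blast
    have a: "majorized (c * n) (c * n + 1) a" and b: "majorized (c * n) (c * n + 1) b"
      using c xy(1,2) x y by blast+
    show "\<exists>h\<in>word_ball sdp S (K * (2 * (c * n + 1)) ^ d). x \<otimes>\<^bsub>sdp\<^esub> h = h \<otimes>\<^bsub>sdp\<^esub> y"
    proof (cases "k = 0")
      case True
      have "fps_cutoff D (act m * b) = fps_cutoff D a"
        using xy(4) True unfolding x y g kl sdp_conj_iff by (simp add: fps_cutoff_diff)
      moreover have "majorized q q a" "majorized q q b"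
        using a b by (auto simp: q_def elim: majorized_mono)
      ultimately obtain m' where m': "fps_cutoff D (act m' * b) = fps_cutoff D a"
        "\<bar>m'\<bar> \<le> int (C * q ^ d)"
        using trivial q1 by blast
      \<comment> \<open>The module is abelian, so a pure power of the stable letter serves as
        conjugator.\<close>
      have "(0, m') \<in> word_ball sdp S (L * nat \<bar>m'\<bar>)" using L[of 0 m'] by simp
      moreover have "L * nat \<bar>m'\<bar> \<le> L * (C * q ^ d)"
        using m'(2) by (intro mult_left_mono) (simp_all only: nat_le_iff zero_le)
      moreover have "L * (C * q ^ d) \<le> K * q ^ d"
        by (simp add: K_def algebra_simps)
      ultimately have "(0, m') \<in> word_ball sdp S (K * q ^ d)"
        by (meson word_ball_mono order_trans)
      moreover have "x \<otimes>\<^bsub>sdp\<^esub> (0, m') = (0, m') \<otimes>\<^bsub>sdp\<^esub> y"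
        unfolding x y sdp_conj_iff using m' True kl by (simp add: fps_cutoff_diff)
      ultimately show ?thesis unfolding q_def by blast
    next
      case False
      \<comment> \<open>Powers of \<open>x\<close> commute with \<open>x\<close>, so the exponent of the conjugator may be reduced modulo \<open>k\<close>.\<close>
      define h where "h = x [^]\<^bsub>sdp\<^esub> (- (m div k)) \<otimes>\<^bsub>sdp\<^esub> g"
      obtain e' where h: "h = (e', m mod k)"
        using sdp_snd_pow[OF xc(1), of "- (m div k)"] x g
        by (cases h) (simp add: h_def minus_div_mult_eq_mod[symmetric] prod_eq_iff)
      have "\<bar>m mod k\<bar> \<le> int (c * n)" using abs_mod_less[OF False, of m] k by linarith
      then have m: "nat \<bar>m mod k\<bar> \<le> c * n" by (simp only: nat_le_iff)
      have "x \<otimes>\<^bsub>sdp\<^esub> h = x [^]\<^bsub>sdp\<^esub> (- (m div k)) \<otimes>\<^bsub>sdp\<^esub> (x \<otimes>\<^bsub>sdp\<^esub> g)"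
        unfolding h_def using xc xy(3) H.commute_int_pow[OF xc(1) xc(1), of "- (m div k)"]
        by (simp add: H.m_assoc[symmetric])
      then have "x \<otimes>\<^bsub>sdp\<^esub> h = h \<otimes>\<^bsub>sdp\<^esub> y"
        unfolding h_def xy(4) using xc xy(3) by (simp add: H.m_assoc)
      then have eq: "fps_cutoff D ((1 - act k) * e') = fps_cutoff D (a - act (m mod k) * b)"
        unfolding x y h sdp_conj_iff by (rule conjunct2)
      have "majorized (1 * (c * n)) (nat \<bar>m mod k\<bar> + (c * n + 1)) (act (m mod k) * b)"
        by (intro majorized_mult majorized_act b)
      then have "majorized (c * n) q (- (act (m mod k) * b))"
        using m by (intro majorized_uminus) (auto simp: q_def elim!: majorized_mono)
      moreover have "majorized (c * n) q a"
        using a by (auto simp: q_def elim: majorized_mono)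
      ultimately have "majorized q q (a - act (m mod k) * b)"
        using majorized_add[of "c * n" q a "c * n" "- (act (m mod k) * b)"]
        by (auto simp: q_def elim: majorized_mono)
      moreover have "\<bar>k\<bar> \<le> int q" using k by (simp add: q_def)
      ultimately obtain c' where
        c': "fps_cutoff D ((1 - act k) * c') = fps_cutoff D (a - act (m mod k) * b)"
        and c'_le: "\<And>i. i < D \<Longrightarrow> \<bar>c' $ i\<bar> \<le> int (C * q ^ d)"
        using nontrivial[OF False _ _ eq] by blast
      define f where "f = fps_cutoff D c'"
      have "(f, m mod k) \<in> word_ball sdp S (L * ((\<Sum>i<D. nat \<bar>f $ i\<bar>) + nat \<bar>m mod k\<bar>))"
        by (intro L) (simp add: f_def)
      moreover have "(\<Sum>i<D. nat \<bar>f $ i\<bar>) \<le> (\<Sum>i<D. C * q ^ d)"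
        using c'_le by (intro sum_mono) (auto simp: f_def nat_le_iff)
      then have "(\<Sum>i<D. nat \<bar>f $ i\<bar>) + nat \<bar>m mod k\<bar> \<le> (D * C + C + 1) * q ^ d"
      proof -
        have "nat \<bar>m mod k\<bar> \<le> c * n" by (rule m)
        also have "\<dots> \<le> q ^ d" using qd by (simp add: q_def)
        finally show ?thesis
          using \<open>(\<Sum>i<D. nat \<bar>f $ i\<bar>) \<le> (\<Sum>i<D. C * q ^ d)\<close> by (simp add: distrib_right mult.assoc)
      qed
      then have "L * ((\<Sum>i<D. nat \<bar>f $ i\<bar>) + nat \<bar>m mod k\<bar>) \<le> K * q ^ d"
        unfolding K_def mult.assoc by (intro mult_left_mono) auto
      ultimately have "(f, m mod k) \<in> word_ball sdp S (K * q ^ d)"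
        by (meson word_ball_mono)
      moreover have "x \<otimes>\<^bsub>sdp\<^esub> (f, m mod k) = (f, m mod k) \<otimes>\<^bsub>sdp\<^esub> y"
        unfolding x y sdp_conj_iff using c' kl by (simp add: f_def)
      ultimately show ?thesis unfolding q_def by blast
    qed
  qed
  moreover define E where "E = K + 2 * c + 2"
  have "K * (2 * (c * n + 1)) ^ d \<le> E * (E * n + E) ^ d + E" for n
  proof -
    have "2 * (c * n + 1) \<le> E * n + E" by (simp add: E_def algebra_simps)
    then have "K * (2 * (c * n + 1)) ^ d \<le> E * (E * n + E) ^ d"
      by (intro mult_mono power_mono) (auto simp: E_def)
    then show ?thesis by simp
  qed
  ultimately show ?thesis
    unfolding growth_le_def by (intro exI[of _ E]) (auto simp: E_def intro: order_trans)
qed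

text \<open>Two words of length C n + C add up to the argument 2 C n + 2 C. The bound is demanded of
  every conjugator because the one realizing \<open>CL_words\<close> is unknown.\<close>

lemma growth_le_CL:
  assumes "C > 0"
    and "\<And>n. \<exists>x\<in>word_ball sdp S (C * n + C). \<exists>y\<in>word_ball sdp S (C * n + C).
      (\<exists>g\<in>carrier sdp. x \<otimes>\<^bsub>sdp\<^esub> g = g \<otimes>\<^bsub>sdp\<^esub> y) \<and>
      (\<forall>j. \<forall>h\<in>word_ball sdp S j. x \<otimes>\<^bsub>sdp\<^esub> h = h \<otimes>\<^bsub>sdp\<^esub> y \<longrightarrow> F n \<le> C * j)"
  shows "F \<preceq> CL sdp S"
proof -
  have "F n \<le> C * CL sdp S (2 * C * n + 2 * C)" for n
  proof -
    obtain x y g where xy: "x \<in> word_ball sdp S (C * n + C)" "y \<in> word_ball sdp S (C * n + C)"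
      "g \<in> carrier sdp" "x \<otimes>\<^bsub>sdp\<^esub> g = g \<otimes>\<^bsub>sdp\<^esub> y"
      and F: "\<And>j h. h \<in> word_ball sdp S j \<Longrightarrow> x \<otimes>\<^bsub>sdp\<^esub> h = h \<otimes>\<^bsub>sdp\<^esub> y \<Longrightarrow> F n \<le> C * j"
      using assms(2)[of n] by blast
    have "(C * n + C) + (C * n + C) = 2 * C * n + 2 * C" by simp
    then show ?thesis
      using CL_conjugator[OF finite_S S_generates xy] F by (metis (no_types, lifting))
  qed
  then have "F n \<le> 2 * C * CL sdp S (2 * C * n + 2 * C) + 2 * C" for n
    by (rule order_trans) simp
  then show ?thesis
    unfolding growth_le_def using assms(1) by (intro exI[of _ "2 * C"]) simp
qed

end

section \<open>Filiform groups and the Klein bottle group\<close>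

definition alt_fps :: "int fps" where
  "alt_fps = Abs_fps (\<lambda>i. (- 1) ^ i)"

lemma one_plus_X_alt: "(1 + fps_X) * alt_fps = 1"
proof (rule fps_ext)
  fix i
  show "((1 + fps_X) * alt_fps) $ i = (1 :: int fps) $ i"
    by (cases i) (simp_all add: alt_fps_def distrib_right)
qed

lemma fps_mult_nth_eq_0:
  fixes f g :: "int fps"
  assumes "\<And>j. j \<le> i \<Longrightarrow> g $ j = 0"
  shows "(f * g) $ i = 0"
  unfolding fps_mult_nth using assms by (intro sum.neutral) auto

text \<open>For \<open>d = 2\<close> this is the discrete Heisenberg group.\<close>

locale filiform = majorized_action d "1 + fps_X" alt_fps for d +
  assumes d_ge_2: "d \<ge> 2"
begin

text \<open>Each factor 1 + X adds 1 to the coefficient of X and each inverse factor removes 1, so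
  the exponent of t can be read off from its action.\<close>

lemma act_nth_0_1: "act m $ 0 = 1 \<and> act m $ 1 = m"
proof (induction m rule: int_induct[where k = 0])
  case (step1 i)
  then show ?case using act_Suc[of i] by (simp add: distrib_right)
next
  case (step2 i)
  then show ?case using act_Suc[of "i - 1"] by (simp add: distrib_right)
qed simp

lemma act_first_order: "act m = 1 + fps_X * fps_shift 1 (act m)"
  using fps_shift_cutoff'[of 1 "act m"] act_nth_0_1[of m]
  by (auto simp: fps_eq_iff)

lemma act_second_order: "act m = 1 + of_int m * fps_X + fps_X ^ 2 * fps_shift 2 (act m)"
proof (rule fps_ext)
  fix i :: nat
  consider "i = 0" | "i = 1" | j where "i = j + 2"
    by (metis One_nat_def add_2_eq_Suc' not0_implies_Suc)
  then show "act m $ i = (1 + of_int m * fps_X + fps_X ^ 2 * fps_shift 2 (act m)) $ i"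
    using act_nth_0_1[of m]
    by cases (auto simp: fps_X_power_mult_nth fps_of_int[symmetric])
qed

text \<open>\<open>act m\<close> keeps the lowest nonzero coefficient g_j and changes the next one
  by exactly m g_j. As g_j is a nonzero integer, a bound on the change bounds m. The next
  coefficient is visible only if j + 1 < d, hence the case distinction.\<close>

lemma solve_translation:
  assumes q: "q \<ge> 1" "majorized q q f" "majorized q q g"
    and eq: "fps_cutoff d (act m * g) = fps_cutoff d f"
  shows "\<exists>m'. fps_cutoff d (act m' * g) = fps_cutoff d f \<and> \<bar>m'\<bar> \<le> int (2 * q ^ d)"
proof (cases "\<forall>i<d - 1. g $ i = 0")
  case True
  \<comment> \<open>\<open>act m - 1\<close> is divisible by X, and g is a multiple of X^(d-1)
    modulo X^d, so every power of t fixes it.\<close>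
  have "fps_cutoff d (act m * g) = fps_cutoff d g"
  proof (subst fps_cutoff_eq_fps_cutoff_iff, intro allI impI)
    fix i assume "i < d"
    then have "i > 0 \<Longrightarrow> (fps_shift 1 (act m) * g) $ (i - 1) = 0"
      using True by (intro fps_mult_nth_eq_0) auto
    then show "(act m * g) $ i = g $ i"
      by (subst act_first_order) (auto simp: distrib_right mult.assoc)
  qed
  then show ?thesis using eq by (intro exI[of _ 0]) simp
next
  case False
  define j where "j = (LEAST i. g $ i \<noteq> 0)"
  from False obtain i where i: "i < d - 1" "g $ i \<noteq> 0" by auto
  have gj: "g $ j \<noteq> 0" unfolding j_def using i(2) by (rule LeastI)
  have j: "j < d - 1" unfolding j_def using i Least_le[of "\<lambda>i. g $ i \<noteq> 0" i] by auto
  have less: "g $ l = 0" if "l < j" for l using that not_less_Least unfolding j_def by blast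
  have "j \<ge> 1 \<Longrightarrow> (fps_shift 2 (act m) * g) $ (j - 1) = 0"
    using less by (intro fps_mult_nth_eq_0) auto
  then have "(act m * g) $ (j + 1) = g $ (j + 1) + m * g $ j"
    by (subst act_second_order)
      (auto simp: distrib_right mult.assoc fps_X_power_mult_nth fps_of_int[symmetric])
  moreover have "(act m * g) $ (j + 1) = f $ (j + 1)"
    using eq j unfolding fps_cutoff_eq_fps_cutoff_iff by auto
  ultimately have "m * g $ j = f $ (j + 1) - g $ (j + 1)" by simp
  then have "\<bar>m * g $ j\<bar> \<le> 2 * int (q * q ^ (j + 1))"
    using majorizedD[OF q(2), of "j + 1"] majorizedD[OF q(3), of "j + 1"] by linarith
  \<comment> \<open>One q is the factor of the majorant and j + 1 come from its rate; j < d - 1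
    gives j + 2 <= d.\<close>
  moreover have "q * q ^ (j + 1) \<le> q ^ d"
    using power_increasing[of "j + 2" d q] j q(1) by simp
  moreover have "\<bar>m\<bar> * 1 \<le> \<bar>m\<bar> * \<bar>g $ j\<bar>"
    using gj by (intro mult_left_mono) auto
  ultimately have "\<bar>m\<bar> \<le> int (2 * q ^ d)"
    unfolding abs_mult by linarith
  then show ?thesis using eq by blast
qed

text \<open>With 1 - \<open>act k\<close> = -X Q and Q_0 = k, coefficient i + 1 of the equation
  expresses k c_i through r and the c_j with j < i. The induction bounds |k| |c_i| rather than
  |c_i|: the factor |k| in the bound on Q is absorbed by the induction hypothesis, so the exponent
  of q grows by only 1 per step.\<close>

lemma solve_difference:
  assumes k: "k \<noteq> 0" "\<bar>k\<bar> \<le> int q" and r: "majorized q q r"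
    and eq: "fps_cutoff d ((1 - act k) * c) = fps_cutoff d r"
  shows "\<exists>c'. fps_cutoff d ((1 - act k) * c') = fps_cutoff d r \<and>
    (\<forall>i<d. \<bar>c' $ i\<bar> \<le> int (2 ^ d * q ^ d))"
proof (intro exI conjI allI impI)
  define Q where "Q = fps_shift 1 (act k)"
  \<comment> \<open>The top coefficient of \<open>c\<close> is annihilated by \<open>1 - act k\<close> modulo \<open>fps_X ^ d\<close> and hence arbitrarily
    large; it has to be dropped.\<close>
  define c' where "c' = fps_cutoff (d - 1) c"
  have act: "1 - act k = - (fps_X * Q)"
    unfolding Q_def by (subst act_first_order[of k]) simp
  have q1: "q \<ge> 1" using k by auto
  show "fps_cutoff d ((1 - act k) * c') = fps_cutoff d r"
    unfolding eq[symmetric]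
  proof (subst fps_cutoff_eq_fps_cutoff_iff, intro allI impI)
    fix i assume "i < d"
    then show "((1 - act k) * c') $ i = ((1 - act k) * c) $ i"
      unfolding act c'_def by (simp add: mult.assoc fps_cutoff_right_mult_nth)
  qed
  have Q0: "Q $ 0 = k" using act_nth_0_1[of k] by (simp add: Q_def)
  \<comment> \<open>Of the l + 1 factors |k| that bound coefficient l + 1 of \<open>act k\<close>,
    only l are replaced by q; the remaining one is spent in the induction below.\<close>
  have Q_le: "\<bar>Q $ l\<bar> \<le> int q ^ l * \<bar>k\<bar>" for l
  proof -
    have "\<bar>Q $ l\<bar> \<le> \<bar>k\<bar> ^ l * \<bar>k\<bar>"
      using majorizedD[OF majorized_act[of k], of "Suc l"] by (simp add: Q_def mult.commute)
    also have "\<dots> \<le> int q ^ l * \<bar>k\<bar>"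
      using k by (intro mult_right_mono power_mono) auto
    finally show ?thesis .
  qed
  have *: "\<bar>k\<bar> * \<bar>c $ i\<bar> \<le> 2 ^ i * int q ^ (i + 2)" if "i + 1 < d" for i
    using that
  proof (induction i rule: less_induct)
    case (less i)
    have "(Q * c) $ i = (\<Sum>j\<le>i. c $ j * Q $ (i - j))"
      by (subst mult.commute) (simp add: fps_mult_nth atLeast0AtMost)
    also have "\<dots> = (\<Sum>j<i. c $ j * Q $ (i - j)) + c $ i * k"
      by (simp add: lessThan_Suc_atMost[symmetric] Q0)
    finally have "(Q * c) $ i = (\<Sum>j<i. c $ j * Q $ (i - j)) + c $ i * k" .
    moreover have "(Q * c) $ i = - r $ (i + 1)"
    proof -
      have "((1 - act k) * c) $ (i + 1) = r $ (i + 1)"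
        using eq less.prems unfolding fps_cutoff_eq_fps_cutoff_iff by blast
      then show ?thesis unfolding act by (simp add: mult.assoc)
    qed
    ultimately have "c $ i * k = - r $ (i + 1) - (\<Sum>j<i. c $ j * Q $ (i - j))" by simp
    then have "\<bar>c $ i * k\<bar> \<le> \<bar>r $ (i + 1)\<bar> + \<bar>\<Sum>j<i. c $ j * Q $ (i - j)\<bar>"
      using abs_triangle_ineq4[of "(- r) $ (i + 1)"] by simp
    also have "\<bar>\<Sum>j<i. c $ j * Q $ (i - j)\<bar> \<le> (\<Sum>j<i. 2 ^ j * int q ^ (i + 2))"
    proof (rule order_trans[OF sum_abs sum_mono])
      fix j assume j: "j \<in> {..<i}"
      have "\<bar>c $ j * Q $ (i - j)\<bar> \<le> \<bar>c $ j\<bar> * (int q ^ (i - j) * \<bar>k\<bar>)"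
        unfolding abs_mult by (intro mult_left_mono Q_le) auto
      also have "\<dots> = int q ^ (i - j) * (\<bar>k\<bar> * \<bar>c $ j\<bar>)" by simp
      also have "\<dots> \<le> int q ^ (i - j) * (2 ^ j * int q ^ (j + 2))"
        using j less.prems by (intro mult_left_mono less.IH) auto
      also have "\<dots> = 2 ^ j * int q ^ ((i - j) + (j + 2))"
        by (simp only: power_add mult_ac)
      finally show "\<bar>c $ j * Q $ (i - j)\<bar> \<le> 2 ^ j * int q ^ (i + 2)" using j by simp
    qed
    \<comment> \<open>Together with the single contribution of r, the geometric sum 2^i - 1
      reproduces the constant 2^i.\<close>
    also have "(\<Sum>j<i. 2 ^ j * int q ^ (i + 2)) = (2 ^ i - 1) * int q ^ (i + 2)"
      by (simp only: sum_distrib_right[symmetric])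
        (simp add: mask_eq_sum_exp lessThan_def[symmetric] flip: power_add)
    also have "\<bar>r $ (i + 1)\<bar> \<le> int q ^ (i + 2)"
      using majorizedD[OF r, of "i + 1"] by simp
    finally show ?case by (simp add: abs_mult algebra_simps)
  qed
  fix i assume "i < d"
  show "\<bar>c' $ i\<bar> \<le> int (2 ^ d * q ^ d)"
  proof (cases "i < d - 1")
    case True
    have "1 * \<bar>c $ i\<bar> \<le> \<bar>k\<bar> * \<bar>c $ i\<bar>"
      using k by (intro mult_right_mono) auto
    also have "\<dots> \<le> 2 ^ i * int q ^ (i + 2)" using True by (intro *) auto
    also have "\<dots> \<le> 2 ^ d * int q ^ d"
      using True q1 by (intro mult_mono power_increasing) auto
    finally show ?thesis using True by (simp add: c'_def)
  qed (simp add: c'_def)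
qed

end

locale filiform_generators = filiform d + sdp_generators d "1 + fps_X" alt_fps S for d S
begin

text \<open>Multiplication by \<open>act N - 1\<close> is the commutator with the \<open>N\<close>-th power of the stable letter, so \<open>d\<close>
  factors \<open>N\<close> are collected in the top coefficient at linear cost in \<open>N\<close>.\<close>

lemma iterated_commutator_ball:
  "\<exists>c. \<forall>N. (fps_cutoff d (of_nat N * (act (int N) - 1) ^ j), 0) \<in> word_ball sdp S (c * N)"
proof -
  obtain L where L: "\<And>f k. (f, k) \<in> carrier sdp \<Longrightarrow>
      (f, k) \<in> word_ball sdp S (L * ((\<Sum>i<d. nat \<bar>f $ i\<bar>) + nat \<bar>k\<bar>))"
    using ball_of_coeffs by blast
  have t: "(0, int N) \<in> word_ball sdp S (L * N)" for N
    using L[of 0 "int N"] by simp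
  show ?thesis
  proof (induction j)
    case 0
    have "(fps_cutoff d (of_nat N), 0) \<in> word_ball sdp S (L * N)" for N
    proof -
      have "(\<Sum>i<d. nat \<bar>fps_cutoff d (of_nat N) $ i\<bar>) = (\<Sum>i<d. if i = 0 then N else 0)"
        by (intro sum.cong) (auto simp: fps_of_nat[symmetric])
      also have "\<dots> = N" using d_ge_2 by simp
      finally show ?thesis using L[of "fps_cutoff d (of_nat N)" 0] by simp
    qed
    then show ?case by auto
  next
    case (Suc j)
    then obtain c where c: "\<And>N. (fps_cutoff d (of_nat N * (act (int N) - 1) ^ j), 0) \<in> word_ball sdp S (c * N)"
      by blast
    have "(fps_cutoff d (of_nat N * (act (int N) - 1) ^ Suc j), 0) \<in>
        word_ball sdp S ((2 * L + 2 * c) * N)" for N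
    proof -
      define f where "f = fps_cutoff d (of_nat N * (act (int N) - 1) ^ j)"
      have f: "(f, 0) \<in> word_ball sdp S (c * N)" using c by (simp add: f_def)
      \<comment> \<open>A commutator contains \<open>t^N\<close> and the previous element twice
        each; the constant grows with j but stays independent of N.\<close>
      have "(0, int N) \<otimes>\<^bsub>sdp\<^esub> (f, 0) \<otimes>\<^bsub>sdp\<^esub> inv\<^bsub>sdp\<^esub> (0, int N) \<otimes>\<^bsub>sdp\<^esub> inv\<^bsub>sdp\<^esub> (f, 0) \<in>
          word_ball sdp S (L * N + c * N + L * N + c * N)"
        using f t by (intro ball_mult ball_inv)
      moreover have "(0, int N) \<otimes>\<^bsub>sdp\<^esub> (f, 0) \<otimes>\<^bsub>sdp\<^esub> inv\<^bsub>sdp\<^esub> (0, int N) \<otimes>\<^bsub>sdp\<^esub> inv\<^bsub>sdp\<^esub> (f, 0) =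
          (fps_cutoff d ((act (int N) - 1) * f), 0)"
        by (simp add: f_def sdp_inv fps_cutoff_add fps_cutoff_diff fps_cutoff_uminus left_diff_distrib)
      moreover have "fps_cutoff d ((act (int N) - 1) * f) =
          fps_cutoff d (of_nat N * (act (int N) - 1) ^ Suc j)"
        by (simp add: f_def mult_ac)
      moreover have "L * N + c * N + L * N + c * N = (2 * L + 2 * c) * N"
        by (simp add: algebra_simps)
      ultimately show ?thesis by simp
    qed
    then show ?case by blast
  qed
qed

text \<open>The exponent of t is undistorted: a word of length j has exponent O(j), so forcing the
  exponent of all conjugators forces their length.\<close>

lemma growth_le_CL_filiform: "(\<lambda>n. n ^ d) \<preceq> CL sdp S"
proof -
  define e where "e = d - 2"
  have d: "d = e + 2" using d_ge_2 by (simp add: e_def)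
  obtain c where c: "\<And>N. (fps_cutoff d (of_nat N * (act (int N) - 1) ^ (e + 1)), 0) \<in> word_ball sdp S (c * N)"
    using iterated_commutator_ball by blast
  \<comment> \<open>\<open>act N - 1\<close> is N X plus higher terms, so modulo X^d its (d-1)-st
    power is N^(d-1) X^(d-1); the prefactor supplies the last N.\<close>
  have top: "fps_cutoff d (of_nat N * (act (int N) - 1) ^ (e + 1)) =
      of_nat (N ^ d) * fps_X ^ (e + 1)" for N
  proof -
    define Q where "Q = fps_shift 1 (act (int N))"
    have "act (int N) - 1 = fps_X * Q"
      unfolding Q_def by (subst act_first_order[of "int N"]) simp
    then have "of_nat N * (act (int N) - 1) ^ (e + 1) = fps_X ^ (e + 1) * (of_nat N * Q ^ (e + 1))"
      by (simp only: power_mult_distrib mult_ac)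
    moreover have "(of_nat N * Q ^ (e + 1)) $ 0 = int (N ^ d)"
      using act_nth_0_1[of "int N"]
      by (simp add: Q_def fps_of_nat[symmetric] fps_nth_power_0 d)
    moreover have "fps_cutoff d (fps_X ^ (e + 1) * P) = of_int (P $ 0) * fps_X ^ (e + 1)"
      for P :: "int fps"
      by (auto simp: fps_eq_iff d fps_X_power_mult_nth fps_of_int[symmetric] simp del: power_Suc)
    ultimately show ?thesis by (simp only: of_int_of_nat_eq)
  qed
  obtain L where L: "\<And>f k. (f, k) \<in> carrier sdp \<Longrightarrow>
      (f, k) \<in> word_ball sdp S (L * ((\<Sum>i<d. nat \<bar>f $ i\<bar>) + nat \<bar>k\<bar>))"
    using ball_of_coeffs by blast
  obtain M where M: "\<And>n f k. (f, k) \<in> word_ball sdp S n \<Longrightarrow> \<bar>k\<bar> \<le> int (M * n)"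
    using ball_majorized by blast
  define x where "x = (fps_X ^ e :: int fps, 0 :: int)"
  obtain l where l: "x \<in> word_ball sdp S l"
  proof -
    have "e < d" by (simp add: d)
    then show thesis
      using that L[of "fps_X ^ e" 0] cutoff_X_power[of e d] by (auto simp: x_def)
  qed
  define C where "C = c + l + M + 1"
  show ?thesis
  proof (rule growth_le_CL[of C])
    fix N
    define y where "y = x \<otimes>\<^bsub>sdp\<^esub> (of_nat (N ^ d) * fps_X ^ (e + 1), 0)"
    have "(of_nat (N ^ d) * fps_X ^ (e + 1), 0) \<in> word_ball sdp S (c * N)"
      using c[of N] unfolding top .
    then have y: "y \<in> word_ball sdp S (l + c * N)"
      unfolding y_def using l by (intro ball_mult)
    have y_eq: "y = (fps_cutoff d (fps_X ^ e * (1 + of_nat (N ^ d) * fps_X)), 0)"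
      by (simp add: y_def x_def distrib_left mult_ac)
    have cut: "fps_cutoff d (fps_X ^ e * P) = of_int (P $ 0) * fps_X ^ e + of_int (P $ 1) * fps_X ^ (e + 1)"
      for P :: "int fps"
      by (auto simp: fps_eq_iff d fps_X_power_mult_nth fps_of_int[symmetric] less_Suc_eq)
    \<comment> \<open>Both elements have t-exponent 0, so f drops out. Next to X^e only the part 1 +
      m X of \<open>act m\<close> survives modulo X^d, and its product with 1 + N^d X has linear
      coefficient m + N^d.\<close>
    have conj: "x \<otimes>\<^bsub>sdp\<^esub> (f, m) = (f, m) \<otimes>\<^bsub>sdp\<^esub> y \<longleftrightarrow> m = - int (N ^ d)" for f m
    proof -
      have "x \<otimes>\<^bsub>sdp\<^esub> (f, m) = (f, m) \<otimes>\<^bsub>sdp\<^esub> y \<longleftrightarrow>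
          fps_cutoff d (fps_X ^ e - act m * (fps_X ^ e * (1 + of_nat (N ^ d) * fps_X))) = 0"
        unfolding x_def y_eq sdp_conj_iff by (auto simp: fps_cutoff_diff)
      also have "fps_X ^ e - act m * (fps_X ^ e * (1 + of_nat (N ^ d) * fps_X)) =
          fps_X ^ e * (1 - act m * (1 + of_nat (N ^ d) * fps_X))"
        by (simp add: algebra_simps)
      also have "fps_cutoff d \<dots> = of_int (- (m + int (N ^ d))) * fps_X ^ (e + 1)"
        unfolding cut using act_nth_0_1[of m]
        by (simp add: distrib_left fps_of_nat[symmetric] fps_mult_nth_1 del: power_Suc of_nat_power)
      also have "\<dots> = 0 \<longleftrightarrow> - (m + int (N ^ d)) = 0"
        by (simp add: fps_of_int[symmetric] del: of_int_minus of_int_add of_nat_power minus_add_distrib neg_equal_0_iff_equal)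
      also have "\<dots> \<longleftrightarrow> m = - int (N ^ d)" by linarith
      finally show ?thesis .
    qed
    show "\<exists>x\<in>word_ball sdp S (C * N + C). \<exists>y\<in>word_ball sdp S (C * N + C).
        (\<exists>g\<in>carrier sdp. x \<otimes>\<^bsub>sdp\<^esub> g = g \<otimes>\<^bsub>sdp\<^esub> y) \<and>
        (\<forall>j. \<forall>h\<in>word_ball sdp S j. x \<otimes>\<^bsub>sdp\<^esub> h = h \<otimes>\<^bsub>sdp\<^esub> y \<longrightarrow> N ^ d \<le> C * j)"
    proof (rule bexI[of _ x], rule bexI[of _ y], intro conjI allI ballI impI)
      show "\<exists>g\<in>carrier sdp. x \<otimes>\<^bsub>sdp\<^esub> g = g \<otimes>\<^bsub>sdp\<^esub> y"
        using conj[of 0 "- int (N ^ d)"] by (intro bexI[of _ "(0, - int (N ^ d))"]) auto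
      show "x \<in> word_ball sdp S (C * N + C)" "y \<in> word_ball sdp S (C * N + C)"
        using l y by (auto elim!: word_ball_mono simp: C_def algebra_simps)
      fix j h assume h: "h \<in> word_ball sdp S j" "x \<otimes>\<^bsub>sdp\<^esub> h = h \<otimes>\<^bsub>sdp\<^esub> y"
      obtain f m where fm: "h = (f, m)" by (cases h)
      have "int (N ^ d) \<le> int (M * j)"
        using conj[of f m] h M[of f m j] fm by auto
      then have "N ^ d \<le> M * j" by (simp only: of_nat_le_iff)
      also have "\<dots> \<le> C * j" by (simp add: C_def distrib_right)
      finally show "N ^ d \<le> C * j" .
    qed
  qed (simp add: C_def)
qed

lemma CL_filiform: "CL sdp S \<simeq> (\<lambda>n. n ^ d)"
  unfolding growth_equiv_def
proof
  show "CL sdp S \<preceq> (\<lambda>n. n ^ d)"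
  \<comment> \<open>The summand 2 comes from \<open>solve_translation\<close>, the summand 2^d from
    \<open>solve_difference\<close>.\<close>
  proof (rule CL_growth_le[of d "2 + 2 ^ d"])
    show "d \<ge> 1" using d_ge_2 by simp
    have le: "int (a * q ^ d) \<le> int ((2 + 2 ^ d) * q ^ d)" if "a \<le> 2 + 2 ^ d" for a q
      using that by (intro of_nat_mono mult_right_mono) auto
    show "\<exists>m'. fps_cutoff d (act m' * g) = fps_cutoff d f \<and> \<bar>m'\<bar> \<le> int ((2 + 2 ^ d) * q ^ d)"
      if "q \<ge> 1" "majorized q q f" "majorized q q g" "fps_cutoff d (act m * g) = fps_cutoff d f"
      for q f g m
      using solve_translation[OF that] le[of 2 q] by (meson le_add1 order_trans)
    show "\<exists>c'. fps_cutoff d ((1 - act k) * c') = fps_cutoff d r \<and>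
        (\<forall>i<d. \<bar>c' $ i\<bar> \<le> int ((2 + 2 ^ d) * q ^ d))"
      if "k \<noteq> 0" "\<bar>k\<bar> \<le> int q" "majorized q q r"
        "fps_cutoff d ((1 - act k) * c) = fps_cutoff d r" for q k r c
      using solve_difference[OF that] le[of "2 ^ d" q] by (meson le_add2 order_trans)
  qed
qed (rule growth_le_CL_filiform)

end

text \<open>The fundamental group of the Klein bottle.\<close>

locale klein_generators = sdp_generators "Suc 0" "- 1" "- 1" S for S
begin

lemma act_cases: "act k = 1 \<or> act k = - 1"
  unfolding act_def by (cases "even (nat \<bar>k\<bar>)") (auto simp: abs_if uminus_power_if)

lemma cutoff_1_eq_iff: "fps_cutoff (Suc 0) f = fps_cutoff (Suc 0) g \<longleftrightarrow> f $ 0 = g $ 0"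
  unfolding fps_cutoff_eq_fps_cutoff_iff by auto

lemma CL_klein: "CL sdp S \<simeq> (\<lambda>n. n ^ 1)"
  unfolding growth_equiv_def
proof
  show "CL sdp S \<preceq> (\<lambda>n. n ^ 1)"
  proof (rule CL_growth_le[of 1 1])
    fix q f g m
    assume "q \<ge> (1 :: nat)" and eq: "fps_cutoff (Suc 0) (act m * g) = fps_cutoff (Suc 0) f"
    \<comment> \<open>Either sign of \<open>act m\<close> is realized by m' = 0 or m' = 1, and 1 <=
      q.\<close>
    then show "\<exists>m'. fps_cutoff (Suc 0) (act m' * g) = fps_cutoff (Suc 0) f \<and> \<bar>m'\<bar> \<le> int (1 * q ^ 1)"
      using act_cases[of m] act_0 act_1
      by (metis (no_types, opaque_lifting) abs_0 abs_1 mult_1 of_nat_0_le_iff of_nat_1 of_nat_mono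
          power_one_right)
  next
    fix q :: nat and k r c
    assume r: "majorized q q r" and eq: "fps_cutoff (Suc 0) ((1 - act k) * c) = fps_cutoff (Suc 0) r"
    show "\<exists>c'. fps_cutoff (Suc 0) ((1 - act k) * c') = fps_cutoff (Suc 0) r \<and>
        (\<forall>i<Suc 0. \<bar>c' $ i\<bar> \<le> int (1 * q ^ 1))"
    proof (cases "act k = 1")
      case True
      \<comment> \<open>This happens for even k: the left-hand side vanishes for every c, so the
        smallest choice is taken.\<close>
      then show ?thesis using eq by (intro exI[of _ 0]) simp
    next
      case False
      then have "act k = - 1" using act_cases by blast
      then have "2 * c $ 0 = r $ 0" using eq unfolding cutoff_1_eq_iff by simp
      then show ?thesis
        using eq majorizedD[OF r, of 0] by (intro exI[of _ c]) auto
    qed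
  qed simp
  obtain L where L: "\<And>f k. (f, k) \<in> carrier sdp \<Longrightarrow>
      (f, k) \<in> word_ball sdp S (L * ((\<Sum>i<Suc 0. nat \<bar>f $ i\<bar>) + nat \<bar>k\<bar>))"
    using ball_of_coeffs by blast
  obtain M where M: "\<And>n f k. (f, k) \<in> word_ball sdp S n \<Longrightarrow> majorized (M * n) (M * n + 1) f"
    using ball_majorized by blast
  define C where "C = 2 * L + M + 1"
  show "(\<lambda>n. n ^ 1) \<preceq> CL sdp S"
  proof (rule growth_le_CL[of C])
    fix n
    define x where "x = (0 :: int fps, 1 :: int)"
    \<comment> \<open>The factor 2 makes the conjugacy solvable over the integers, since 1 -
      \<open>act 1\<close> is 2.\<close>
    define y where "y = (of_int (2 * int n) :: int fps, 1 :: int)"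
    have cut: "fps_cutoff (Suc 0) (of_int i) = (of_int i :: int fps)" for i
      by (auto simp: fps_eq_iff fps_of_int[symmetric])
    have x: "x \<in> word_ball sdp S L" using L[of 0 1] by (simp add: x_def)
    have y: "y \<in> word_ball sdp S (L * (2 * n + 1))"
    proof -
      have "nat \<bar>of_int (2 * int n) $ 0\<bar> = 2 * n"
        by (simp add: fps_of_int[symmetric] nat_mult_distrib del: of_int_mult)
      then show ?thesis
        using L[of "of_int (2 * int n)" 1] by (simp add: y_def cut del: of_int_mult)
    qed
    have conj: "x \<otimes>\<^bsub>sdp\<^esub> (f, m) = (f, m) \<otimes>\<^bsub>sdp\<^esub> y \<longleftrightarrow> f $ 0 = - (act m $ 0) * int n" for f m
    proof -
      have y0: "(of_int (2 * int n) :: int fps) $ 0 = 2 * int n"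
        by (simp only: fps_of_int[symmetric] fps_nth_fps_const) simp
      have two: "(1 - act 1) $ 0 = 2" by simp
      have "x \<otimes>\<^bsub>sdp\<^esub> (f, m) = (f, m) \<otimes>\<^bsub>sdp\<^esub> y \<longleftrightarrow>
          ((1 - act 1) * f) $ 0 = (0 - act m * of_int (2 * int n)) $ 0"
        unfolding x_def y_def sdp_conj_iff cutoff_1_eq_iff by (simp only: simp_thms)
      also have "\<dots> \<longleftrightarrow> 2 * f $ 0 = - (act m $ 0 * (2 * int n))"
        by (simp only: two y0 fps_mult_nth_0 fps_neg_nth diff_0)
      also have "- (act m $ 0 * (2 * int n)) = 2 * (- (act m $ 0) * int n)" by algebra
      also have "(2 * f $ 0 = 2 * (- (act m $ 0) * int n)) \<longleftrightarrow> f $ 0 = - (act m $ 0) * int n"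
        by (rule mult_left_cancel) simp
      finally show ?thesis .
    qed
    show "\<exists>x\<in>word_ball sdp S (C * n + C). \<exists>y\<in>word_ball sdp S (C * n + C).
        (\<exists>g\<in>carrier sdp. x \<otimes>\<^bsub>sdp\<^esub> g = g \<otimes>\<^bsub>sdp\<^esub> y) \<and>
        (\<forall>j. \<forall>h\<in>word_ball sdp S j. x \<otimes>\<^bsub>sdp\<^esub> h = h \<otimes>\<^bsub>sdp\<^esub> y \<longrightarrow> n ^ 1 \<le> C * j)"
    proof (rule bexI[of _ x], rule bexI[of _ y], intro conjI allI ballI impI)
      show "\<exists>g\<in>carrier sdp. x \<otimes>\<^bsub>sdp\<^esub> g = g \<otimes>\<^bsub>sdp\<^esub> y"
      proof (rule bexI)
        have "(of_int (- int n) :: int fps) $ 0 = - int n"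
          by (simp only: fps_of_int[symmetric] fps_nth_fps_const) simp
        then show "x \<otimes>\<^bsub>sdp\<^esub> (of_int (- int n), 0) = (of_int (- int n), 0) \<otimes>\<^bsub>sdp\<^esub> y"
          unfolding conj by simp
        show "(of_int (- int n), 0) \<in> carrier sdp"
          unfolding sdp_simps(1) by (rule cut)
      qed
      show "x \<in> word_ball sdp S (C * n + C)" "y \<in> word_ball sdp S (C * n + C)"
        using x y by (auto elim!: word_ball_mono simp: C_def algebra_simps)
      fix j h assume h: "h \<in> word_ball sdp S j" "x \<otimes>\<^bsub>sdp\<^esub> h = h \<otimes>\<^bsub>sdp\<^esub> y"
      obtain f m where fm: "h = (f, m)" by (cases h)
      have "\<bar>f $ 0\<bar> = int n" using conj[of f m] h fm act_cases[of m] by auto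
      \<comment> \<open>At coefficient 0 the rate has exponent 0, so only the linear factor
        \<open>M * j\<close> remains.\<close>
      moreover have "\<bar>f $ 0\<bar> \<le> int (M * j)" using majorizedD[OF M, of f m j 0] h fm by simp
      ultimately have "n \<le> M * j" by (simp only: of_nat_le_iff)
      also have "\<dots> \<le> C * j" by (simp add: C_def distrib_right)
      finally show "n ^ 1 \<le> C * j" by simp
    qed
  qed (simp add: C_def)
qed

end

theorem theorem1:
  fixes d :: nat
  assumes "d \<ge> 1"
  shows "\<exists>G :: nat gword set monoid. group G \<and> finitely_presented G \<and>
    (\<forall>S. finite S \<and> S \<subseteq> carrier G \<and> generate G S = carrier G \<longrightarrow> CL G S \<simeq> (\<lambda>n. n ^ d))"
proof (cases "d = 1")
  case True
  interpret majorized_action "Suc 0" "- 1" "- 1"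
    by unfold_locales (simp_all add: majorized_def)
  have "CL sdp S \<simeq> (\<lambda>n. n ^ d)"
    if "finite S" "S \<subseteq> carrier sdp" "generate sdp S = carrier sdp" for S
  proof -
    interpret klein_generators S by unfold_locales (use that in auto)
    show ?thesis using CL_klein True by simp
  qed
  then show ?thesis
    using CL_presented_eqI finitely_presented_sdp group_presented_group[OF sdp_relators_gwords] by blast
next
  case False
  interpret filiform d
    using False assms one_plus_X_alt
    by unfold_locales (auto simp: majorized_def alt_fps_def power_0_left)
  have "CL sdp S \<simeq> (\<lambda>n. n ^ d)"
    if "finite S" "S \<subseteq> carrier sdp" "generate sdp S = carrier sdp" for S
  proof -
    interpret filiform_generators d S by unfold_locales (use that in auto)
    show ?thesis by (rule CL_filiform)
  qed
  then show ?thesis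
    using CL_presented_eqI finitely_presented_sdp group_presented_group[OF sdp_relators_gwords] by blast
qed

end
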